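(* Let $\Phi\subseteq V^*$ be an essential root system all of whose irreducible components are of classical type ($\mathrm A$, $\mathrm B$, $\mathrm C$ or $\mathrm D$), with root lattice $\mathcal L\subseteq V^*$. Let $B\subseteq\mathcal L$ be an M-convex set of type $\Phi$ and $p\in B$. Then $$\mathrm T_p(\operatorname{conv}B)=\operatorname{cone}\{\alpha\in\Phi : p+\alpha\in B\}.$$
   Context: Root systems. $V$ is a finite-dimensional real inner product space with dual $V^*$, $\langle p,x\rangle=p(x)$ for $p\in V^*,x\in V$; $V^*$ carries the induced inner product. For $\alpha\in V^*\setminus\{0\}$, $\alpha^\vee\in V$ is $2/\|\alpha\|^2$ times the vector of $V$ representing $\alpha$, and $s_\alpha(p)=p-\langle p,\alpha^\vee\rangle\alpha$. A root system is a nonempty finite set $\Phi\subseteq V^*\setminus\{0\}$ with $s_\alpha(\beta)\in\Phi$, $\mathbb R\alpha\cap\Phi=\{\alpha,-\alpha\}$ and $\langle\alpha,\beta^\vee\rangle\in\mathbb Z$ for all $\alpha,\beta\in\Phi$. It is essential if $\operatorname{span}\Phi=V^*$; it decomposes uniquely into mutually orthogonal irreducible components. The root lattice $\mathcal L$ is the set of integer linear combinations of roots. For a closed convex $P\subseteq V^*$ and $p\in P$, $\mathrm T_p(P)=\operatorname{cl}(\operatorname{cone}\{q-p:q\in P\})$ is the tangent cone, where $\operatorname{cone}$ denotes the conical hull (set of nonnegative finite combinations, $\operatorname{cone}\emptyset=\{0\}$). An M-convex cone of type $\Phi$ is a cone $\operatorname{cone}\Phi'$ with $\Phi'\subseteq\Phi$.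 An M-convex polyhedron of type $\Phi$ is a nonempty closed convex set $P\subseteq V^*$ such that $\mathrm T_p(P)$ is an M-convex cone for all $p\in P$ (such $P$ is a polyhedron); it is integral if $P=\operatorname{conv}(P\cap\mathcal L)$. A nonempty set $B\subseteq\mathcal L$ is M-convex of type $\Phi$ if $B=P\cap\mathcal L$ for some integral M-convex polyhedron $P$ of type $\Phi$. *)

theory Defs
  imports "HOL-Analysis.Analysis"
begin

text \<open>
  Convention: the type \<open>'a :: euclidean_space\<close> plays the role of the dual space \<open>V\<^sup>*\<close> with its
  induced inner product. The space \<open>V\<close> is identified with \<open>V\<^sup>*\<close> by the Riesz isometry, so the
  vector of \<open>V\<close> representing \<open>\<alpha> \<in> V\<^sup>*\<close> is \<open>\<alpha>\<close> itself and the pairing of \<open>p \<in> V\<^sup>*\<close> with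
  \<open>x \<in> V\<close> is \<open>p \<bullet> x\<close>.
\<close>

definition coroot :: "'a::euclidean_space \<Rightarrow> 'a" where
  "coroot \<alpha> = (2 / (norm \<alpha>)\<^sup>2) *\<^sub>R \<alpha>"

definition reflection :: "'a::euclidean_space \<Rightarrow> 'a \<Rightarrow> 'a" where
  "reflection \<alpha> p = p - (p \<bullet> coroot \<alpha>) *\<^sub>R \<alpha>"

definition root_system :: "'a::euclidean_space set \<Rightarrow> bool" where
  "root_system \<Phi> \<longleftrightarrow>
     finite \<Phi> \<and> \<Phi> \<noteq> {} \<and> 0 \<notin> \<Phi> \<and>
     (\<forall>\<alpha>\<in>\<Phi>. \<forall>\<beta>\<in>\<Phi>. reflection \<alpha> \<beta> \<in> \<Phi>) \<and>
     (\<forall>\<alpha>\<in>\<Phi>. range (\<lambda>c::real. c *\<^sub>R \<alpha>) \<inter> \<Phi> = {\<alpha>, - \<alpha>}) \<and>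
     (\<forall>\<alpha>\<in>\<Phi>. \<forall>\<beta>\<in>\<Phi>. \<alpha> \<bullet> coroot \<beta> \<in> \<int>)"

definition essential :: "'a::euclidean_space set \<Rightarrow> bool" where
  "essential \<Phi> \<longleftrightarrow> span \<Phi> = UNIV"

definition mutually_orthogonal :: "'a::euclidean_space set \<Rightarrow> 'a set \<Rightarrow> bool" where
  "mutually_orthogonal S T \<longleftrightarrow> (\<forall>x\<in>S. \<forall>y\<in>T. x \<bullet> y = 0)"

definition irreducible_root_system :: "'a::euclidean_space set \<Rightarrow> bool" where
  "irreducible_root_system \<Phi> \<longleftrightarrow>
     root_system \<Phi> \<and>
     \<not> (\<exists>\<Phi>1 \<Phi>2. \<Phi>1 \<noteq> {} \<and> \<Phi>2 \<noteq> {} \<and> \<Phi>1 \<union> \<Phi>2 = \<Phi> \<and> \<Phi>1 \<inter> \<Phi>2 = {} \<and>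
          mutually_orthogonal \<Phi>1 \<Phi>2)"

definition irreducible_component :: "'a::euclidean_space set \<Rightarrow> 'a set \<Rightarrow> bool" where
  "irreducible_component \<Phi> \<Psi> \<longleftrightarrow>
     \<Psi> \<subseteq> \<Phi> \<and> irreducible_root_system \<Psi> \<and> mutually_orthogonal \<Psi> (\<Phi> - \<Psi>)"

text \<open>
  The standard models of the classical root systems live in \<open>\<real>\<^sup>N\<close> with \<open>N\<close> depending on the rank
  (\<open>N = n + 1\<close> for type A and \<open>N = n\<close> otherwise). A vector of \<open>\<real>\<^sup>N\<close> is encoded as a function
  \<open>nat \<Rightarrow> real\<close> vanishing at all indices \<open>\<ge> N\<close>; coordinates are numbered from 0.
\<close>

definition unit_coord :: "nat \<Rightarrow> nat \<Rightarrow> real" where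
  "unit_coord i k = (if k = i then 1 else 0)"

definition model_inner :: "nat \<Rightarrow> (nat \<Rightarrow> real) \<Rightarrow> (nat \<Rightarrow> real) \<Rightarrow> real" where
  "model_inner N x y = (\<Sum>k<N. x k * y k)"

definition model_A :: "nat \<Rightarrow> (nat \<Rightarrow> real) set" where
  "model_A n = {(\<lambda>k. unit_coord i k - unit_coord j k) | i j. i \<le> n \<and> j \<le> n \<and> i \<noteq> j}"

definition model_D :: "nat \<Rightarrow> (nat \<Rightarrow> real) set" where
  "model_D n = {(\<lambda>k. s * unit_coord i k + t * unit_coord j k) | s t i j.
                  s \<in> {1, -1} \<and> t \<in> {1, -1} \<and> i < n \<and> j < n \<and> i \<noteq> j}"

definition model_B :: "nat \<Rightarrow> (nat \<Rightarrow> real) set" where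
  "model_B n = model_D n \<union> {(\<lambda>k. s * unit_coord i k) | s i. s \<in> {1, -1} \<and> i < n}"

definition model_C :: "nat \<Rightarrow> (nat \<Rightarrow> real) set" where
  "model_C n = model_D n \<union> {(\<lambda>k. 2 * s * unit_coord i k) | s i. s \<in> {1, -1} \<and> i < n}"

text \<open>
  An isomorphism of root systems is a linear isomorphism of the spans that maps roots onto roots and
  preserves the integers \<open>\<langle>\<alpha>, \<beta>\<^sup>\<or>\<rangle>\<close>. It need not be an isometry, since irreducible root systems are
  classified only up to scaling. Here it is given by its coordinate functionals, extended linearly
  to the whole space.
\<close>

definition isomorphic_to_model :: "nat \<Rightarrow> 'a::euclidean_space set \<Rightarrow> (nat \<Rightarrow> real) set \<Rightarrow> bool" where
  "isomorphic_to_model N \<Psi> M \<longleftrightarrow>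
     (\<exists>f :: 'a \<Rightarrow> nat \<Rightarrow> real.
        (\<forall>i. linear (\<lambda>x. f x i)) \<and> inj_on f (span \<Psi>) \<and> f ` \<Psi> = M \<and>
        (\<forall>\<alpha>\<in>\<Psi>. \<forall>\<beta>\<in>\<Psi>.
           \<alpha> \<bullet> coroot \<beta> = 2 * model_inner N (f \<alpha>) (f \<beta>) / model_inner N (f \<beta>) (f \<beta>)))"

text \<open>
  The rank bounds are the customary ones; they lose no irreducible system because
  \<open>B\<^sub>1 = C\<^sub>1 = A\<^sub>1\<close>, \<open>C\<^sub>2 = B\<^sub>2\<close>, \<open>D\<^sub>3 = A\<^sub>3\<close> up to isomorphism and \<open>D\<^sub>2\<close> is reducible.
\<close>

definition classical_type :: "'a::euclidean_space set \<Rightarrow> bool" where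
  "classical_type \<Psi> \<longleftrightarrow>
     (\<exists>n\<ge>1. isomorphic_to_model (n + 1) \<Psi> (model_A n)) \<or>
     (\<exists>n\<ge>2. isomorphic_to_model n \<Psi> (model_B n)) \<or>
     (\<exists>n\<ge>3. isomorphic_to_model n \<Psi> (model_C n)) \<or>
     (\<exists>n\<ge>4. isomorphic_to_model n \<Psi> (model_D n))"

definition root_lattice :: "'a::euclidean_space set \<Rightarrow> 'a set" where
  "root_lattice \<Phi> = {(\<Sum>\<alpha>\<in>\<Phi>. of_int (c \<alpha>) *\<^sub>R \<alpha>) | c :: 'a \<Rightarrow> int. True}"

text \<open>
  The conical hull is the library's \<open>convex_cone hull\<close>, which always contains 0. The library's
  \<open>cone hull\<close> is not convex and is empty for the empty set.
\<close>

definition tangent_cone :: "'a::euclidean_space \<Rightarrow> 'a set \<Rightarrow> 'a set" where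
  "tangent_cone p P = closure (convex_cone hull ((\<lambda>q. q - p) ` P))"

definition M_convex_cone :: "'a::euclidean_space set \<Rightarrow> 'a set \<Rightarrow> bool" where
  "M_convex_cone \<Phi> C \<longleftrightarrow> (\<exists>\<Phi>'\<subseteq>\<Phi>. C = convex_cone hull \<Phi>')"

definition M_convex_polyhedron :: "'a::euclidean_space set \<Rightarrow> 'a set \<Rightarrow> bool" where
  "M_convex_polyhedron \<Phi> P \<longleftrightarrow>
     P \<noteq> {} \<and> closed P \<and> convex P \<and> (\<forall>p\<in>P. M_convex_cone \<Phi> (tangent_cone p P))"

definition integral_M_convex_polyhedron :: "'a::euclidean_space set \<Rightarrow> 'a set \<Rightarrow> bool" where
  "integral_M_convex_polyhedron \<Phi> P \<longleftrightarrow>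
     M_convex_polyhedron \<Phi> P \<and> P = convex hull (P \<inter> root_lattice \<Phi>)"

definition M_convex_set :: "'a::euclidean_space set \<Rightarrow> 'a set \<Rightarrow> bool" where
  "M_convex_set \<Phi> B \<longleftrightarrow>
     B \<noteq> {} \<and> B \<subseteq> root_lattice \<Phi> \<and>
     (\<exists>P. integral_M_convex_polyhedron \<Phi> P \<and> B = P \<inter> root_lattice \<Phi>)"

end

theory Submission
  imports Defs
begin

text \<open>
  Write \<open>P\<close> for the convex hull of \<open>B\<close>. Every neighbour \<open>p + \<alpha> \<in> B\<close> has \<open>\<alpha>\<close> in the tangent cone, so
  the point is that the tangent cone \<open>T\<close> at \<open>p\<close> is generated by roots \<open>\<alpha>\<close> with \<open>p + \<alpha> \<in> P\<close>.

  The coordinates of the classical models, taken block by block over the irreducible components,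
  embed the ambient space linearly into some \<open>\<real>\<^sup>I\<close> in such a way that every root becomes
  \<open>\<plusminus> e\<^sub>i\<close>, \<open>\<plusminus> 2 e\<^sub>i\<close> or \<open>\<plusminus> e\<^sub>i \<plusminus> e\<^sub>j\<close> and the root lattice has integer coordinates. Two facts drive the
  argument. First, the lineality space \<open>W\<close> of the tangent cone at \<open>q \<in> P\<close> is spanned by roots, and
  integrality of \<open>P\<close> provides a lattice point \<open>z \<in> P\<close> with \<open>z - q \<in> W\<close>
  (\<open>lineality_span_roots\<close>, \<open>lineality_hull_point\<close>). Secondly, if a subspace \<open>W\<close> spanned by roots does
  not contain \<open>e\<^sub>i\<close>, then a linear functional with coefficients in \<open>{-1, 0, 1}\<close> and coefficient 1 at \<open>i\<close>
  vanishes on \<open>W\<close> (\<open>annihilator\<close>). So if one leaves \<open>p\<close> in a direction \<open>a = \<plusminus> e\<^sub>i\<close> of \<open>T\<close> and \<open>q = p + \<tau> a\<close>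
  is the last point of \<open>P\<close>, this functional applied to \<open>z - q\<close> shows that \<open>\<tau>\<close> is an integer; hence
  \<open>p + a \<in> P\<close> (\<open>unit_step\<close>).

  Next, \<open>T\<close> is cut by the closed orthants into pointed cones, which are generated by their extreme
  rays (Krein-Milman). An extreme ray spans the set of those vectors of a root subspace that vanish
  at the zero coordinates of the ray, and the annihilator lemma forces it to be a multiple of some
  \<open>\<plusminus> e\<^sub>i\<close> or \<open>\<plusminus> e\<^sub>i \<plusminus> e\<^sub>j\<close>; the same integrality argument then shows that the full step stays in \<open>P\<close>.
  Hence \<open>T\<close> is generated by the vectors \<open>a\<close> of these two forms with \<open>p + a \<in> P\<close>
  (\<open>tangent_cone_short_steps\<close>).

  It remains to replace such vectors by roots. A vector \<open>\<plusminus> e\<^sub>i \<plusminus> e\<^sub>j\<close> inside one block is a root (in type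
  A because coordinate sums vanish); across two blocks it splits into two unit vectors, because \<open>T\<close>
  is generated by roots and so is preserved by the projections to the components. A unit vector
  \<open>a = \<plusminus> e\<^sub>i\<close> is a root in type B and does not exist in type A. In types C and D the lattice has even
  coordinate sums, so \<open>p + a\<close> is not a lattice point, and a parity argument
  (\<open>even_coordinate_sum\<close>) yields some \<open>e\<^sub>j\<close> in the same block in the lineality space at \<open>p + a\<close>. If
  \<open>j \<noteq> i\<close>, then \<open>a\<close> is half the sum of the roots \<open>a + e\<^sub>j\<close> and \<open>a - e\<^sub>j\<close>, both of which lead from \<open>p\<close>
  into \<open>P\<close> by unit steps starting at \<open>p + a\<close>. If \<open>j = i\<close>, then in type C the root \<open>2 a\<close> leads from \<open>p\<close> into
  \<open>P\<close>, and in type D a root of the lineality space that involves \<open>e\<^sub>i\<close> supplies an index \<open>j \<noteq> i\<close>.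
\<close>

section \<open>Tangent cones and their lineality spaces\<close>

lemma convex_cone_tangent_cone:
  assumes "P \<noteq> {}" shows "convex_cone (tangent_cone p P)"
proof -
  let ?C = "convex_cone hull ((\<lambda>q. q - p) ` P)"
  have C: "convex_cone ?C" by (rule convex_cone_convex_cone_hull)
  have "convex (closure ?C)" using C by (simp add: convex_cone_def convex_closure)
  moreover have "conic (closure ?C)" using C by (simp add: convex_cone_def conic_closure)
  moreover have "closure ?C \<noteq> {}" using C by (simp add: convex_cone_def)
  ultimately show ?thesis unfolding tangent_cone_def by (simp add: convex_cone_def)
qed

lemma diff_in_tangent_cone: "q \<in> P \<Longrightarrow> q - p \<in> tangent_cone p P"
  unfolding tangent_cone_def by (rule subsetD[OF closure_subset]) (simp add: hull_inc)

lemma tangent_cone_inner_le: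
  assumes "\<And>y. y \<in> P \<Longrightarrow> \<nu> \<bullet> (y - p) \<le> 0" and "w \<in> tangent_cone p P"
  shows "\<nu> \<bullet> w \<le> 0"
proof -
  have "convex_cone hull ((\<lambda>q. q - p) ` P) \<subseteq> {x. \<nu> \<bullet> x \<le> 0}"
    by (rule hull_minimal) (use assms(1) in \<open>auto simp: convex_cone_halfspace_le\<close>)
  then have "tangent_cone p P \<subseteq> {x. \<nu> \<bullet> x \<le> 0}"
    unfolding tangent_cone_def by (rule closure_minimal) (rule closed_halfspace_le)
  with assms(2) show ?thesis by auto
qed

lemma tangent_cone_stepI:
  assumes "P \<noteq> {}" "p + t *\<^sub>R v \<in> P" "t > 0"
  shows "v \<in> tangent_cone p P"
proof -
  have "t *\<^sub>R v \<in> tangent_cone p P"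
    using diff_in_tangent_cone[OF assms(2), of p] by simp
  then have "(1/t) *\<^sub>R (t *\<^sub>R v) \<in> tangent_cone p P"
    using assms convex_cone_scaleR[OF convex_cone_tangent_cone[OF assms(1), of p]]
    by (metis less_eq_real_def zero_less_divide_1_iff)
  then show ?thesis using assms by simp
qed

lemma convex_step_le:
  assumes "convex P" "p \<in> P" "p + t *\<^sub>R v \<in> P" "0 \<le> s" "s \<le> t"
  shows "p + s *\<^sub>R v \<in> P"
proof (cases "t = 0")
  case False
  then have "(1 - s/t) *\<^sub>R p + (s/t) *\<^sub>R (p + t *\<^sub>R v) \<in> P"
    using assms by (intro convexD) auto
  then show ?thesis using False by (simp add: algebra_simps)
qed (use assms in auto)

text \<open>
  The closure in the definition of the tangent cone adds no directions: every tangent direction can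
  be followed inside \<open>P\<close> for a positive time. This fails for general closed convex sets (for instance
  a disc); it holds here because only finitely many cones occur as tangent cones.
\<close>
lemma tangent_step:
  assumes "finite \<Phi>" "M_convex_polyhedron \<Phi> P" "p \<in> P" "v \<in> tangent_cone p P"
  obtains t where "t > 0" "p + t *\<^sub>R v \<in> P"
proof -
  have P: "closed P" "convex P" "P \<noteq> {}" and M: "\<And>q. q \<in> P \<Longrightarrow> M_convex_cone \<Phi> (tangent_cone q P)"
    using assms(2) unfolding M_convex_polyhedron_def by auto
  define x where "x n = p + (1 / real (Suc n)) *\<^sub>R v" for n
  define y where "y n = closest_point P (x n)" for n
  have yP: "y n \<in> P" for n unfolding y_def using P by (simp add: closest_point_in_set)
  \<comment> \<open>Both \<open>x n\<close> and its nearest point \<open>y n\<close> tend to \<open>p\<close>, and one cone is the tangent cone at infinitely many \<open>y n\<close>.\<close>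
  have "(\<lambda>n. tangent_cone (y n) P) ` UNIV \<subseteq> (\<lambda>X. convex_cone hull X) ` Pow \<Phi>"
  proof (rule image_subsetI)
    fix n
    obtain X where "X \<subseteq> \<Phi>" "tangent_cone (y n) P = convex_cone hull X"
      using M[OF yP[of n]] unfolding M_convex_cone_def by blast
    then show "tangent_cone (y n) P \<in> (\<lambda>X. convex_cone hull X) ` Pow \<Phi>" by blast
  qed
  then have "finite ((\<lambda>n. tangent_cone (y n) P) ` UNIV)"
    using assms(1) finite_subset by blast
  from pigeonhole_infinite[OF infinite_UNIV_nat this]
  obtain m where m: "infinite {n. tangent_cone (y n) P = tangent_cone (y m) P}"
    by auto
  define \<nu> where "\<nu> = x m - y m"
  have normal: "\<nu> \<bullet> (z - y m) \<le> 0" if "z \<in> P" for z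
    unfolding \<nu>_def y_def using closest_point_dot[OF P(2,1) that] by simp
  have near: "dist (y n) p \<le> 2 * norm v / Suc n" for n
  proof -
    have xp: "dist (x n) p = norm v / Suc n" by (simp add: x_def dist_norm)
    have "dist (x n) (y n) \<le> dist (x n) p"
      unfolding y_def by (rule closest_point_le[OF P(1) assms(3)])
    then show ?thesis using xp dist_triangle[of "y n" p "x n"] by (simp add: dist_commute)
  qed
  \<comment> \<open>The outer normal at \<open>y m\<close> is a normal at each \<open>y n\<close> with the same tangent cone, hence in the limit at \<open>p\<close>.\<close>
  have normal_p: "\<nu> \<bullet> (z - p) \<le> 0" if z: "z \<in> P" for z
  proof (rule ccontr)
    assume "\<not> ?thesis"
    then have pos: "\<nu> \<bullet> (z - p) > 0" by simp
    obtain N :: nat where N: "2 * norm v * norm \<nu> / (\<nu> \<bullet> (z - p)) < N"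
      using reals_Archimedean2 by blast
    obtain n where n: "n \<ge> N" "tangent_cone (y n) P = tangent_cone (y m) P"
      using m unfolding infinite_nat_iff_unbounded_le by auto
    have "\<nu> \<bullet> (z - y n) \<le> 0"
      by (rule tangent_cone_inner_le[OF normal]) (use diff_in_tangent_cone[OF z, of "y n"] n in auto)
    then have "\<nu> \<bullet> (z - p) \<le> \<nu> \<bullet> (y n - p)" by (simp add: inner_diff_right)
    also have "\<dots> \<le> norm \<nu> * dist (y n) p" by (metis dist_norm norm_cauchy_schwarz)
    also have "\<dots> \<le> norm \<nu> * (2 * norm v / Suc n)" by (intro mult_left_mono near) auto
    finally have "(\<nu> \<bullet> (z - p)) * Suc n \<le> 2 * norm v * norm \<nu>" by (simp add: field_simps)
    moreover have "2 * norm v * norm \<nu> < (\<nu> \<bullet> (z - p)) * N"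
      using N pos by (simp add: field_simps)
    moreover have "(\<nu> \<bullet> (z - p)) * N \<le> (\<nu> \<bullet> (z - p)) * Suc n"
      using n pos by (intro mult_left_mono) auto
    ultimately show False by linarith
  qed
  have "\<nu> \<bullet> v \<le> 0" by (rule tangent_cone_inner_le[OF normal_p assms(4)])
  moreover have "\<nu> \<bullet> (p - y m) \<le> 0" by (rule normal[OF assms(3)])
  moreover have "\<nu> \<bullet> \<nu> = (1 / Suc m) * (\<nu> \<bullet> v) + \<nu> \<bullet> (p - y m)"
    by (simp add: \<nu>_def x_def algebra_simps)
  moreover have "(1 / Suc m) * (\<nu> \<bullet> v) \<le> 0"
    using \<open>\<nu> \<bullet> v \<le> 0\<close> by (intro mult_nonneg_nonpos) auto
  ultimately have "\<nu> \<bullet> \<nu> \<le> 0" by linarith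
  then have "\<nu> = 0" by (metis inner_gt_zero_iff not_le)
  then have "x m \<in> P" using yP[of m] by (simp add: \<nu>_def)
  then show thesis using that[of "1 / Suc m"] by (simp add: x_def)
qed

text \<open>
  The lineality space of the tangent cone at \<open>q\<close>: the directions in which \<open>q\<close> can be moved both ways.
  For \<open>q\<close> in a polyhedron it is the direction space of the smallest face containing \<open>q\<close>.
\<close>
definition lineality :: "'a::euclidean_space set \<Rightarrow> 'a \<Rightarrow> 'a set" where
  "lineality P q = {w. w \<in> tangent_cone q P \<and> - w \<in> tangent_cone q P}"

lemma subspace_lineality:
  assumes "P \<noteq> {}" shows "subspace (lineality P q)"
proof -
  have T: "convex_cone (tangent_cone q P)" by (rule convex_cone_tangent_cone[OF assms])
  show ?thesis
    unfolding subspace_def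
  proof (intro conjI ballI allI)
    show "0 \<in> lineality P q" using convex_cone_contains_0[OF T] by (simp add: lineality_def)
    show "v + w \<in> lineality P q" if "v \<in> lineality P q" "w \<in> lineality P q" for v w
      using that convex_cone_add[OF T, of v w] convex_cone_add[OF T, of "- v" "- w"]
      by (simp add: lineality_def)
    show "c *\<^sub>R w \<in> lineality P q" if "w \<in> lineality P q" for c w
      using that convex_cone_scaleR[OF T, of c w] convex_cone_scaleR[OF T, of c "- w"]
        convex_cone_scaleR[OF T, of "- c" w] convex_cone_scaleR[OF T, of "- c" "- w"]
      by (cases "c \<ge> 0") (simp_all add: lineality_def)
  qed
qed

lemma lineality_step:
  assumes "finite \<Phi>" "M_convex_polyhedron \<Phi> P" "q \<in> P" "w \<in> lineality P q"
  obtains \<epsilon> where "\<epsilon> > 0" "q + \<epsilon> *\<^sub>R w \<in> P" "q - \<epsilon> *\<^sub>R w \<in> P"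
proof -
  have P: "convex P" using assms(2) by (simp add: M_convex_polyhedron_def)
  obtain s where s: "s > 0" "q + s *\<^sub>R w \<in> P"
    using tangent_step[OF assms(1-3), of w] assms(4) unfolding lineality_def by blast
  obtain t where t: "t > 0" "q + t *\<^sub>R (- w) \<in> P"
    using tangent_step[OF assms(1-3), of "- w"] assms(4) unfolding lineality_def by blast
  show thesis
  proof (rule that)
    show "min s t > 0" using s t by simp
    show "q + min s t *\<^sub>R w \<in> P"
      using s t by (intro convex_step_le[OF P assms(3) s(2)]) auto
    have "q + min s t *\<^sub>R (- w) \<in> P"
      using s t by (intro convex_step_le[OF P assms(3) t(2)]) auto
    then show "q - min s t *\<^sub>R w \<in> P" by simp
  qed
qed

lemma linealityI:
  assumes "\<epsilon> > 0" "q + \<epsilon> *\<^sub>R w \<in> P" "q - \<epsilon> *\<^sub>R w \<in> P"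
  shows "w \<in> lineality P q"
  using assms tangent_cone_stepI[of P q \<epsilon> w] tangent_cone_stepI[of P q \<epsilon> "-w"]
  by (auto simp: lineality_def)

text \<open>
  Moving from \<open>q\<close> towards any other point of \<open>P\<close> can only enlarge the lineality space, as long as that
  other point is not reached.
\<close>
lemma lineality_segment:
  assumes "finite \<Phi>" "M_convex_polyhedron \<Phi> P" "p \<in> P" "q \<in> P" "0 < \<mu>" "\<mu> \<le> 1"
  shows "lineality P q \<subseteq> lineality P (p + \<mu> *\<^sub>R (q - p))"
proof
  fix w assume "w \<in> lineality P q"
  then obtain \<epsilon> where e: "\<epsilon> > 0" "q + \<epsilon> *\<^sub>R w \<in> P" "q - \<epsilon> *\<^sub>R w \<in> P"
    using lineality_step[OF assms(1,2,4)] by blast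
  have P: "convex P" using assms(2) by (simp add: M_convex_polyhedron_def)
  have "(1 - \<mu>) *\<^sub>R p + \<mu> *\<^sub>R (q + \<epsilon> *\<^sub>R w) \<in> P" "(1 - \<mu>) *\<^sub>R p + \<mu> *\<^sub>R (q - \<epsilon> *\<^sub>R w) \<in> P"
    using assms e by (auto intro!: convexD[OF P])
  then show "w \<in> lineality P (p + \<mu> *\<^sub>R (q - p))"
    using e assms by (intro linealityI[of "\<mu> * \<epsilon>"]) (auto simp: algebra_simps)
qed

lemma lineality_span_roots:
  assumes "M_convex_polyhedron \<Phi> P" "q \<in> P"
  shows "lineality P q = span (\<Phi> \<inter> lineality P q)"
proof
  obtain R where R: "R \<subseteq> \<Phi>" and T: "tangent_cone q P = convex_cone hull R"
    using assms unfolding M_convex_polyhedron_def M_convex_cone_def by meson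
  let ?C = "convex_cone hull R"
  \<comment> \<open>\<open>?D\<close> is a convex cone containing \<open>R\<close>: if a sum of elements of the cone lies in the lineality space, so do the summands.\<close>
  let ?D = "{x \<in> ?C. - x \<in> ?C \<longrightarrow> x \<in> span (\<Phi> \<inter> lineality P q)}"
  have C: "convex_cone ?C" by (rule convex_cone_convex_cone_hull)
  have "convex_cone ?D"
  proof (rule iffD2[OF convex_cone_iff], intro conjI ballI allI impI)
    show "0 \<in> ?D" using convex_cone_contains_0[OF C] by (simp add: span_zero)
  next
    fix x y assume x: "x \<in> ?D" and y: "y \<in> ?D"
    have "x + y \<in> span (\<Phi> \<inter> lineality P q)" if "- (x + y) \<in> ?C"
    proof -
      have "- x \<in> ?C" "- y \<in> ?C"
        using convex_cone_add[OF C that, of x] convex_cone_add[OF C that, of y] x y by simp_all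
      then show ?thesis using x y by (auto intro: span_add)
    qed
    then show "x + y \<in> ?D" using x y convex_cone_add[OF C] by auto
  next
    fix x and c :: real assume x: "x \<in> ?D" and c: "0 \<le> c"
    have "c *\<^sub>R x \<in> span (\<Phi> \<inter> lineality P q)" if "- (c *\<^sub>R x) \<in> ?C"
    proof (cases "c = 0")
      case False
      then have "(1/c) *\<^sub>R (- (c *\<^sub>R x)) \<in> ?C"
        using that c by (intro convex_cone_scaleR[OF C]) auto
      then show ?thesis using x False by (auto intro: span_scale)
    qed (simp add: span_zero)
    then show "c *\<^sub>R x \<in> ?D" using x c convex_cone_scaleR[OF C] by auto
  qed
  moreover have "R \<subseteq> ?D"
    using R by (auto simp: lineality_def T hull_inc intro!: span_base)
  ultimately have "?C \<subseteq> ?D" by (simp add: hull_minimal)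
  then show "lineality P q \<subseteq> span (\<Phi> \<inter> lineality P q)"
    by (auto simp: lineality_def T)
next
  have "P \<noteq> {}" using assms by auto
  then show "span (\<Phi> \<inter> lineality P q) \<subseteq> lineality P q"
    by (intro span_minimal subspace_lineality) auto
qed

text \<open>
  A point of the convex hull of \<open>P \<inter> L\<close> lies in the relative interior of the hull of the points that
  have positive weight in some representation; any of these points can serve as \<open>z\<close>.
\<close>
lemma lineality_hull_point:
  assumes "convex P" "q \<in> convex hull (P \<inter> L)"
  obtains z where "z \<in> P \<inter> L" "z - q \<in> lineality P q"
proof -
  obtain S u where S: "finite S" "S \<subseteq> P \<inter> L" and u: "\<And>v. v \<in> S \<Longrightarrow> 0 \<le> u v" "sum u S = 1"
    and q: "(\<Sum>v\<in>S. u v *\<^sub>R v) = q"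
    using assms(2) unfolding convex_hull_explicit by blast
  obtain z where z: "z \<in> S" "u z \<noteq> 0" using u(2) by (metis sum.neutral zero_neq_one)
  have zpos: "u z > 0" using u(1)[OF z(1)] z(2) by simp
  have ne: "P \<noteq> {}" using S z by auto
  have T: "convex_cone (tangent_cone q P)" by (rule convex_cone_tangent_cone[OF ne])
  have "(\<Sum>v\<in>S. u v *\<^sub>R (v - q)) = 0"
    using u(2) q by (simp add: algebra_simps sum_subtractf flip: scaleR_sum_left)
  then have split: "u z *\<^sub>R (z - q) + (\<Sum>v\<in>S - {z}. u v *\<^sub>R (v - q)) = 0"
    using S(1) z(1) by (simp add: sum.remove)
  have rest: "- (z - q) = (1 / u z) *\<^sub>R (\<Sum>v\<in>S - {z}. u v *\<^sub>R (v - q))"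
  proof -
    from split have "(\<Sum>v\<in>S - {z}. u v *\<^sub>R (v - q)) = u z *\<^sub>R (- (z - q))"
      by (simp only: scaleR_minus_right add_eq_0_iff)
    then show ?thesis using zpos by (simp only:) simp
  qed
  have sumT: "(\<Sum>v\<in>A. u v *\<^sub>R (v - q)) \<in> tangent_cone q P" if "A \<subseteq> S" for A
  proof -
    have "finite A" using that S(1) finite_subset by blast
    then show ?thesis using that
    proof induction
      case empty
      then show ?case using convex_cone_contains_0[OF T] by simp
    next
      case (insert v A)
      then show ?case using S u
        by (auto intro!: convex_cone_add[OF T] convex_cone_scaleR[OF T] diff_in_tangent_cone)
    qed
  qed
  have "- (z - q) \<in> tangent_cone q P"
    unfolding rest using zpos by (intro convex_cone_scaleR[OF T] sumT) auto
  moreover have "z - q \<in> tangent_cone q P" using S z by (intro diff_in_tangent_cone) auto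
  ultimately show thesis using that[of z] S z by (auto simp: lineality_def)
qed

lemma last_point:
  fixes P :: "'a::euclidean_space set"
  assumes "closed P" "convex P" "p \<in> P" "p + a \<notin> P"
  obtains \<tau> where "0 \<le> \<tau>" "\<tau> < 1" "p + \<tau> *\<^sub>R a \<in> P" "\<forall>t. p + t *\<^sub>R a \<in> P \<longrightarrow> t \<le> \<tau>"
proof -
  define A where "A = {t. 0 \<le> t \<and> p + t *\<^sub>R a \<in> P}"
  have le1: "t < 1" if "p + t *\<^sub>R a \<in> P" for t
    using convex_step_le[OF assms(2,3) that, of 1] assms(4) by (cases "t \<ge> 1") auto
  have "A \<noteq> {}" using assms(3) by (auto simp: A_def intro!: exI[of _ 0])
  moreover have bdd: "bdd_above A" using le1 by (auto simp: A_def bdd_above_def intro: less_imp_le)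
  moreover have "closed A"
  proof -
    have "closed ((\<lambda>t. p + t *\<^sub>R a) -` P)"
      by (rule closed_vimage[OF assms(1)]) (intro continuous_on_add continuous_on_scaleR
          continuous_on_const continuous_on_id)
    moreover have "A = {0..} \<inter> (\<lambda>t. p + t *\<^sub>R a) -` P" by (auto simp: A_def)
    ultimately show ?thesis by (simp add: closed_Int)
  qed
  ultimately have "Sup A \<in> A" by (intro closed_contains_Sup)
  moreover have "t \<le> Sup A" if "p + t *\<^sub>R a \<in> P" for t
  proof (cases "t \<ge> 0")
    case True
    then show ?thesis using that bdd by (intro cSup_upper) (auto simp: A_def)
  next
    case False
    then show ?thesis using \<open>Sup A \<in> A\<close> by (auto simp: A_def)
  qed
  ultimately show thesis using that[of "Sup A"] le1 by (auto simp: A_def)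
qed

section \<open>Signed coordinates and annihilators of root subspaces\<close>

text \<open>
  Linear coordinates in which each root is a nonzero multiple of a unit vector \<open>e\<^sub>i\<close> or a vector
  \<open>\<plusminus> e\<^sub>i \<plusminus> e\<^sub>j\<close> with \<open>i \<noteq> j\<close>. The coordinate map is injective but need not be onto: in type A no vector
  of the space has coordinates \<open>e\<^sub>i\<close>.
\<close>
locale signed_coordinates =
  fixes \<Phi> :: "'a::euclidean_space set" and I :: "'i set" and x :: "'i \<Rightarrow> 'a \<Rightarrow> real"
  assumes finite_I: "finite I"
    and linear_x: "i \<in> I \<Longrightarrow> linear (x i)"
    and separating: "(\<And>i. i \<in> I \<Longrightarrow> x i v = 0) \<Longrightarrow> v = 0"
    and root_coords: "\<alpha> \<in> \<Phi> \<Longrightarrow>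
      (\<exists>i\<in>I. \<exists>m. \<forall>k\<in>I. m \<noteq> 0 \<and> x k \<alpha> = m * of_bool (k = i)) \<or>
      (\<exists>i\<in>I. \<exists>j\<in>I. \<exists>s\<in>{1, -1}. \<exists>t\<in>{1, -1}. i \<noteq> j \<and>
         (\<forall>k\<in>I. x k \<alpha> = s * of_bool (k = i) + t * of_bool (k = j)))"
begin

text \<open>
  Some vector of \<open>W\<close> has the coordinates \<open>g\<close>.
\<close>
definition attains :: "'a set \<Rightarrow> ('i \<Rightarrow> real) \<Rightarrow> bool" where
  "attains W g \<longleftrightarrow> (\<exists>v\<in>W. \<forall>k\<in>I. x k v = g k)"

text \<open>
  The coordinates are \<open>\<plusminus> e\<^sub>i\<close>, respectively \<open>\<plusminus> e\<^sub>i \<plusminus> e\<^sub>j\<close>.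
\<close>
definition unit_form :: "'a \<Rightarrow> bool" where
  "unit_form a \<longleftrightarrow> (\<exists>i\<in>I. \<exists>s\<in>{1, -1}. \<forall>k\<in>I. x k a = s * of_bool (k = i))"

definition pair_form :: "'a \<Rightarrow> bool" where
  "pair_form a \<longleftrightarrow> (\<exists>i\<in>I. \<exists>j\<in>I. \<exists>s\<in>{1, -1}. \<exists>t\<in>{1, -1}. i \<noteq> j \<and>
     (\<forall>k\<in>I. x k a = s * of_bool (k = i) + t * of_bool (k = j)))"

lemma coords_simps:
  assumes "i \<in> I"
  shows "x i (v + w) = x i v + x i w" "x i (v - w) = x i v - x i w" "x i (c *\<^sub>R v) = c * x i v"
    "x i (- v) = - x i v" "x i 0 = 0"
  using linear_x[OF assms] by (simp_all add: linear_add linear_diff linear_scale linear_neg linear_0)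

lemma coords_eqI:
  assumes "\<And>i. i \<in> I \<Longrightarrow> x i v = x i w" shows "v = w"
  using separating[of "v - w"] assms by (simp add: coords_simps)

lemma attains_add: "subspace W \<Longrightarrow> attains W g \<Longrightarrow> attains W h \<Longrightarrow> attains W (\<lambda>k. g k + h k)"
  unfolding attains_def using coords_simps subspace_add by metis

lemma attains_scale: "subspace W \<Longrightarrow> attains W g \<Longrightarrow> attains W (\<lambda>k. c * g k)"
  unfolding attains_def using coords_simps subspace_scale by metis

lemma attains_cong: "attains W g \<Longrightarrow> (\<And>k. k \<in> I \<Longrightarrow> g k = h k) \<Longrightarrow> attains W h"
  unfolding attains_def by auto

lemma attains_mono: "attains W g \<Longrightarrow> W \<subseteq> W' \<Longrightarrow> attains W' g"
  unfolding attains_def by auto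

lemma attains_coords: "v \<in> W \<Longrightarrow> attains W (\<lambda>k. x k v)"
  unfolding attains_def by auto

lemma sum_of_bool:
  fixes f :: "'i \<Rightarrow> real"
  assumes "i \<in> I" shows "(\<Sum>k\<in>I. f k * (c * of_bool (k = i))) = c * f i"
proof -
  have "(\<Sum>k\<in>I. f k * (c * of_bool (k = i))) = (\<Sum>k\<in>I. if i = k then c * f k else 0)"
    by (intro sum.cong) auto
  then show ?thesis using assms finite_I by simp
qed

text \<open>
  The functional \<open>\<epsilon>\<close> records which \<open>\<plusminus> e\<^sub>k\<close> are congruent to \<open>e\<^sub>i\<close> modulo \<open>W\<close>. Both signs cannot occur for
  the same \<open>k\<close>, since then \<open>e\<^sub>i\<close> itself would lie in \<open>W\<close>.
\<close>
lemma annihilator: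
  assumes R: "R \<subseteq> \<Phi>" and W: "W = span R" and i: "i \<in> I" and no: "\<not> attains W (\<lambda>k. of_bool (k = i))"
  obtains \<epsilon> where "\<epsilon> i = (1::real)" "\<And>k. \<epsilon> k \<in> {-1, 0, 1}"
    "\<And>k. \<epsilon> k \<noteq> 0 \<Longrightarrow> attains W (\<lambda>l. of_bool (l = i) - \<epsilon> k * of_bool (l = k))"
    "\<And>w. w \<in> W \<Longrightarrow> (\<Sum>k\<in>I. \<epsilon> k * x k w) = 0"
proof -
  have sub: "subspace W" by (simp add: W)
  define near where "near c k \<longleftrightarrow> attains W (\<lambda>l. of_bool (l = i) - c * of_bool (l = k))" for c k
  define \<epsilon> :: "'i \<Rightarrow> real" where "\<epsilon> k = (if near 1 k then 1 else if near (-1) k then -1 else 0)" for k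
  have not_both: "\<not> (near 1 k \<and> near (-1) k)" for k
  proof
    assume "near 1 k \<and> near (-1) k"
    then have "attains W (\<lambda>l. (1/2) * ((of_bool (l = i) - 1 * of_bool (l = k))
        + (of_bool (l = i) - (-1) * of_bool (l = k))))"
      unfolding near_def by (intro attains_scale attains_add sub) auto
    then have "attains W (\<lambda>l. of_bool (l = i))" by (rule attains_cong) simp
    then show False using no by blast
  qed
  have eps_eq: "\<epsilon> k = c" if "near c k" "c \<in> {1, -1}" for c k
    using that not_both[of k] unfolding \<epsilon>_def by auto
  have near_eps: "near (\<epsilon> k) k" if "\<epsilon> k \<noteq> 0" for k
    using that unfolding \<epsilon>_def by (auto split: if_splits)
  \<comment> \<open>If \<open>\<plusminus> e\<^sub>k\<close> is congruent to \<open>e\<^sub>i\<close>, a root \<open>s e\<^sub>k + t e\<^sub>l\<close> of \<open>W\<close> passes the congruence on to \<open>\<plusminus> e\<^sub>l\<close>.\<close>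
  have transfer: "s * \<epsilon> k + t * \<epsilon> l = 0"
    if \<alpha>: "\<alpha> \<in> W" "\<And>n. n \<in> I \<Longrightarrow> x n \<alpha> = s * of_bool (n = k) + t * of_bool (n = l)"
      and st: "s \<in> {1, -1}" "t \<in> {1, -1}" and k: "\<epsilon> k \<noteq> 0" for \<alpha> s t k l
  proof -
    have ek: "\<epsilon> k \<in> {1, -1}" using k unfolding \<epsilon>_def by (auto split: if_splits)
    have "attains W (\<lambda>n. (of_bool (n = i) - \<epsilon> k * of_bool (n = k)) + (s * \<epsilon> k) * x n \<alpha>)"
      using near_eps[OF k] unfolding near_def
      by (intro attains_add attains_scale attains_coords \<alpha>(1) sub)
    then have "near (- (s * t * \<epsilon> k)) l"
      unfolding near_def by (rule attains_cong) (use st in \<open>auto simp: \<alpha>(2) algebra_simps\<close>)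
    then have "\<epsilon> l = - (s * t * \<epsilon> k)" by (rule eps_eq) (use st ek in auto)
    then show ?thesis using st by auto
  qed
  have on_root: "(\<Sum>k\<in>I. \<epsilon> k * x k \<alpha>) = 0" if \<alpha>: "\<alpha> \<in> R" for \<alpha>
  proof -
    have \<alpha>W: "\<alpha> \<in> W" using \<alpha> by (simp add: W span_base)
    from root_coords[of \<alpha>] \<alpha> R consider
      (axis) k m where "k \<in> I" "m \<noteq> 0" "\<forall>n\<in>I. x n \<alpha> = m * of_bool (n = k)"
      | (pair) k l s t where "k \<in> I" "l \<in> I" "s \<in> {1, -1}" "t \<in> {1, -1}"
          "\<forall>n\<in>I. x n \<alpha> = s * of_bool (n = k) + t * of_bool (n = l)"
      by blast
    then show ?thesis
    proof cases
      case axis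
      have "\<epsilon> k = 0"
      proof (rule ccontr)
        assume k: "\<epsilon> k \<noteq> 0"
        have "attains W (\<lambda>n. (of_bool (n = i) - \<epsilon> k * of_bool (n = k)) + (\<epsilon> k / m) * x n \<alpha>)"
          using near_eps[OF k] unfolding near_def
          by (intro attains_add attains_scale attains_coords \<alpha>W sub)
        then have "attains W (\<lambda>n. of_bool (n = i))"
          by (rule attains_cong) (use axis in auto)
        then show False using no by blast
      qed
      moreover have "(\<Sum>n\<in>I. \<epsilon> n * x n \<alpha>) = (\<Sum>n\<in>I. \<epsilon> n * (m * of_bool (n = k)))"
        using axis by (intro sum.cong) auto
      ultimately show ?thesis using sum_of_bool[OF axis(1), of \<epsilon> m] by simp
    next
      case pair
      have "(\<Sum>n\<in>I. \<epsilon> n * x n \<alpha>)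
          = (\<Sum>n\<in>I. \<epsilon> n * (s * of_bool (n = k))) + (\<Sum>n\<in>I. \<epsilon> n * (t * of_bool (n = l)))"
        unfolding sum.distrib[symmetric] using pair by (intro sum.cong) (auto simp: algebra_simps)
      also have "\<dots> = s * \<epsilon> k + t * \<epsilon> l" by (simp only: sum_of_bool[OF pair(1)] sum_of_bool[OF pair(2)])
      also have "\<dots> = 0"
      proof (cases "\<epsilon> k = 0")
        case True
        show ?thesis
        proof (cases "\<epsilon> l = 0")
          case False
          then have "t * \<epsilon> l + s * \<epsilon> k = 0"
            using pair by (intro transfer[OF \<alpha>W]) (auto simp: add.commute)
          then show ?thesis by simp
        qed (use True in simp)
      next
        case False
        then show ?thesis using pair by (intro transfer[OF \<alpha>W]) auto
      qed
      finally show ?thesis .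
    qed
  qed
  have lin: "linear (\<lambda>w. \<Sum>k\<in>I. \<epsilon> k * x k w)"
    by (rule linearI) (auto simp: coords_simps algebra_simps sum.distrib sum_distrib_left)
  show thesis
  proof (rule that[of \<epsilon>])
    have "near 1 i" unfolding near_def attains_def
      using subspace_0[OF sub] coords_simps(5) by (intro bexI[of _ 0]) auto
    then show "\<epsilon> i = 1" by (simp add: \<epsilon>_def)
    show "\<epsilon> k \<in> {-1, 0, 1}" for k by (simp add: \<epsilon>_def)
    show "attains W (\<lambda>l. of_bool (l = i) - \<epsilon> k * of_bool (l = k))" if "\<epsilon> k \<noteq> 0" for k
      using near_eps[OF that] by (simp add: near_def)
    show "(\<Sum>k\<in>I. \<epsilon> k * x k w) = 0" if "w \<in> W" for w
      using linear_eq_0_on_span[OF lin, of R w] on_root that W by blast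
  qed
qed

text \<open>
  If the vectors of a root subspace \<open>W\<close> supported in the support of \<open>v \<in> W\<close> are just the multiples of
  \<open>v\<close>, then \<open>v\<close> is a multiple of some \<open>\<plusminus> e\<^sub>i\<close> or \<open>\<plusminus> e\<^sub>i \<plusminus> e\<^sub>j\<close>. For \<open>i\<close> in the support of \<open>v\<close>, either \<open>e\<^sub>i\<close>
  lies in \<open>W\<close>, or the annihilator at \<open>i\<close>, being 0 on \<open>v\<close>, has a second index \<open>j\<close> in the support of \<open>v\<close>
  and provides a vector \<open>e\<^sub>i \<plusminus> e\<^sub>j\<close> of \<open>W\<close>.
\<close>
lemma minimal_support_form:
  assumes R: "R \<subseteq> \<Phi>" and W: "W = span R" and v: "v \<in> W" "v \<noteq> 0"
    and minimal: "\<And>u. u \<in> W \<Longrightarrow> (\<And>k. k \<in> I \<Longrightarrow> x k v = 0 \<Longrightarrow> x k u = 0) \<Longrightarrow> \<exists>c. u = c *\<^sub>R v"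
  obtains c a where "c > 0" "v = c *\<^sub>R a" "unit_form a \<or> pair_form a"
proof -
  \<comment> \<open>The vector found can be a negative multiple of \<open>v\<close>; both forms are closed under negation.\<close>
  note conclude = that
  have oriented: thesis
    if u: "u \<in> W" "u \<noteq> 0" "\<And>k. k \<in> I \<Longrightarrow> x k v = 0 \<Longrightarrow> x k u = 0"
      and form: "unit_form u \<or> pair_form u" "unit_form (- u) \<or> pair_form (- u)" for u
  proof -
    obtain c where c: "u = c *\<^sub>R v" using minimal u by blast
    then have "c \<noteq> 0" using u by auto
    then have "v = (1/c) *\<^sub>R u" "v = (-1/c) *\<^sub>R (- u)" using c by auto
    then show thesis using conclude[of "1/c" u] conclude[of "-1/c" "- u"] form \<open>c \<noteq> 0\<close>
      by (cases "c > 0") (auto simp: zero_less_divide_iff)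
  qed
  obtain i where i: "i \<in> I" "x i v \<noteq> 0" using separating v by blast
  show thesis
  proof (cases "attains W (\<lambda>k. of_bool (k = i))")
    case True
    then obtain u where u: "u \<in> W" "\<forall>k\<in>I. x k u = of_bool (k = i)" by (auto simp: attains_def)
    have "unit_form u" unfolding unit_form_def
      using u i by (intro bexI[of _ i] bexI[of _ 1]) auto
    moreover have "unit_form (- u)" unfolding unit_form_def
      using u i by (intro bexI[of _ i] bexI[of _ "-1"]) (auto simp: coords_simps)
    moreover have "u \<noteq> 0" using u i by (auto simp: coords_simps)
    moreover have "x k u = 0" if "k \<in> I" "x k v = 0" for k using that u(2) i(2) by auto
    ultimately show thesis using oriented[OF u(1)] by blast
  next
    case False
    obtain \<epsilon> where \<epsilon>: "\<epsilon> i = (1::real)" "\<And>k. \<epsilon> k \<in> {-1, 0, 1}"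
      "\<And>k. \<epsilon> k \<noteq> 0 \<Longrightarrow> attains W (\<lambda>l. of_bool (l = i) - \<epsilon> k * of_bool (l = k))"
      "\<And>w. w \<in> W \<Longrightarrow> (\<Sum>k\<in>I. \<epsilon> k * x k w) = 0"
      using annihilator[OF R W i(1) False] by blast
    have "(\<Sum>k\<in>I - {i}. \<epsilon> k * x k v) \<noteq> 0"
      using \<epsilon>(4)[OF v(1)] i \<epsilon>(1) sum.remove[OF finite_I i(1), of "\<lambda>k. \<epsilon> k * x k v"] by simp
    then obtain j where j: "j \<in> I - {i}" "\<epsilon> j * x j v \<noteq> 0" by (meson sum.neutral)
    obtain u where u: "u \<in> W" "\<forall>k\<in>I. x k u = of_bool (k = i) - \<epsilon> j * of_bool (k = j)"
      using \<epsilon>(3)[of j] j by (auto simp: attains_def)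
    have e: "\<epsilon> j \<in> {1, -1}" using \<epsilon>(2)[of j] j by auto
    have "pair_form u" unfolding pair_form_def
      using u i j e by (intro bexI[of _ i] bexI[of _ j] bexI[of _ 1] bexI[of _ "- \<epsilon> j"]) auto
    moreover have "pair_form (- u)" unfolding pair_form_def
      using u i j e by (intro bexI[of _ i] bexI[of _ j] bexI[of _ "-1"] bexI[of _ "\<epsilon> j"])
        (auto simp: coords_simps)
    moreover have "u \<noteq> 0"
    proof
      assume "u = 0"
      then have "x i u = 0" using coords_simps(5)[OF i(1)] by simp
      then show False using u(2) i j by auto
    qed
    moreover have "x k u = 0" if "k \<in> I" "x k v = 0" for k using that u(2) i(2) j(2) by auto
    ultimately show thesis using oriented[OF u(1)] by blast
  qed
qed

end

section \<open>Integrality of unit and pair steps\<close>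

text \<open>
  A polyhedron with root tangent cones that is the convex hull of its points in a set \<open>L\<close> of vectors
  with integer coordinates.
\<close>
locale integral_polyhedron = signed_coordinates \<Phi> I x
  for \<Phi> :: "'a::euclidean_space set" and I :: "'i set" and x :: "'i \<Rightarrow> 'a \<Rightarrow> real" +
  fixes P L :: "'a set"
  assumes finite_roots: "finite \<Phi>"
    and polyhedron: "M_convex_polyhedron \<Phi> P"
    and hull: "P = convex hull (P \<inter> L)"
    and lattice_Ints: "z \<in> L \<Longrightarrow> k \<in> I \<Longrightarrow> x k z \<in> \<int>"
begin

lemma P_facts: "closed P" "convex P" "P \<noteq> {}"
  using polyhedron by (auto simp: M_convex_polyhedron_def)

lemmas step_in_P = tangent_step[OF finite_roots polyhedron]
lemmas lineality_step_in_P = lineality_step[OF finite_roots polyhedron]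
lemmas lineality_span = lineality_span_roots[OF polyhedron]

lemma lattice_point_near:
  assumes "q \<in> P" obtains z where "z \<in> P" "z \<in> L" "z - q \<in> lineality P q"
  using lineality_hull_point[OF P_facts(2), of q L] hull assms by blast

text \<open>
  Suppose that \<open>q = p + \<tau> a\<close> with \<open>0 < \<tau> < 1\<close> were the last point of \<open>P\<close> in direction \<open>a\<close>. A functional \<open>\<epsilon>\<close>
  with integer coefficients that kills the lineality space at \<open>q\<close> takes the same value at \<open>q\<close> and at
  some point of \<open>L\<close>, hence an integer. As its value at \<open>p\<close> is an integer and its value on \<open>a\<close> is \<open>\<plusminus> 1\<close>,
  \<open>\<tau>\<close> is an integer, a contradiction.
\<close>
lemma integral_step:
  assumes p: "p \<in> P" "\<And>k. k \<in> I \<Longrightarrow> x k p \<in> \<int>" and a: "a \<in> tangent_cone p P"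
    and ann: "\<And>\<tau>. 0 < \<tau> \<Longrightarrow> \<tau> < 1 \<Longrightarrow> p + \<tau> *\<^sub>R a \<in> P \<Longrightarrow> (\<And>t. p + t *\<^sub>R a \<in> P \<Longrightarrow> t \<le> \<tau>) \<Longrightarrow>
      a \<notin> lineality P (p + \<tau> *\<^sub>R a) \<Longrightarrow>
      \<exists>\<epsilon>. (\<forall>k\<in>I. \<epsilon> k \<in> \<int>) \<and> \<bar>\<Sum>k\<in>I. \<epsilon> k * x k a\<bar> = 1 \<and>
          (\<forall>w\<in>lineality P (p + \<tau> *\<^sub>R a). (\<Sum>k\<in>I. \<epsilon> k * x k w) = 0)"
  shows "p + a \<in> P"
proof (rule ccontr)
  assume out: "p + a \<notin> P"
  obtain \<tau> where "0 \<le> \<tau>" "\<tau> < 1" "p + \<tau> *\<^sub>R a \<in> P" "\<forall>t. p + t *\<^sub>R a \<in> P \<longrightarrow> t \<le> \<tau>"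
    by (rule last_point[OF P_facts(1,2) p(1) out])
  then have \<tau>: "0 \<le> \<tau>" "\<tau> < 1" "p + \<tau> *\<^sub>R a \<in> P" "\<And>t. p + t *\<^sub>R a \<in> P \<Longrightarrow> t \<le> \<tau>" by auto
  obtain t where "t > 0" "p + t *\<^sub>R a \<in> P" using step_in_P[OF p(1) a] by blast
  then have pos: "0 < \<tau>" using \<tau>(4)[of t] by linarith
  define q where "q = p + \<tau> *\<^sub>R a"
  have q: "q \<in> P" using \<tau> by (simp add: q_def)
  have a_out: "a \<notin> lineality P q"
  proof
    assume "a \<in> lineality P q"
    then obtain e where "e > 0" "q + e *\<^sub>R a \<in> P" using lineality_step_in_P[OF q] by blast
    then show False using \<tau>(4)[of "\<tau> + e"] by (simp add: q_def algebra_simps)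
  qed
  have "\<exists>\<epsilon>. (\<forall>k\<in>I. \<epsilon> k \<in> \<int>) \<and> \<bar>\<Sum>k\<in>I. \<epsilon> k * x k a\<bar> = 1 \<and>
          (\<forall>w\<in>lineality P q. (\<Sum>k\<in>I. \<epsilon> k * x k w) = 0)"
    unfolding q_def using a_out by (intro ann[OF pos \<tau>(2,3,4)]) (auto simp: q_def)
  then obtain \<epsilon> where \<epsilon>: "\<And>k. k \<in> I \<Longrightarrow> \<epsilon> k \<in> \<int>" "\<bar>\<Sum>k\<in>I. \<epsilon> k * x k a\<bar> = 1"
      "\<And>w. w \<in> lineality P q \<Longrightarrow> (\<Sum>k\<in>I. \<epsilon> k * x k w) = 0"
    by blast
  obtain z where z: "z \<in> L" "z - q \<in> lineality P q" using lattice_point_near[OF q] by blast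
  have "(\<Sum>k\<in>I. \<epsilon> k * x k (z - q))
      = (\<Sum>k\<in>I. \<epsilon> k * (x k z - x k p) - \<tau> * (\<epsilon> k * x k a))"
    by (intro sum.cong) (auto simp: q_def coords_simps algebra_simps)
  also have "\<dots> = (\<Sum>k\<in>I. \<epsilon> k * (x k z - x k p)) - \<tau> * (\<Sum>k\<in>I. \<epsilon> k * x k a)"
    by (simp add: sum_subtractf sum_distrib_left)
  finally have "\<tau> * (\<Sum>k\<in>I. \<epsilon> k * x k a) = (\<Sum>k\<in>I. \<epsilon> k * (x k z - x k p))"
    using \<epsilon>(3)[OF z(2)] by simp
  also have "\<dots> \<in> \<int>"
    using \<epsilon>(1) p(2) lattice_Ints[OF z(1)] by (intro Ints_sum Ints_mult Ints_diff) auto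
  finally have "\<bar>\<tau> * (\<Sum>k\<in>I. \<epsilon> k * x k a)\<bar> \<in> \<int>" by (rule Ints_abs)
  then have "\<tau> \<in> \<int>" using \<epsilon>(2) pos by (simp add: abs_mult)
  then obtain n :: int where "\<tau> = of_int n" by (auto elim: Ints_cases)
  then show False using pos \<tau>(2) by simp
qed

lemma unit_step:
  assumes p: "p \<in> P" "\<And>k. k \<in> I \<Longrightarrow> x k p \<in> \<int>" and a: "a \<in> tangent_cone p P" "unit_form a"
  shows "p + a \<in> P"
proof (rule integral_step[OF p a(1)])
  fix \<tau> assume q: "p + \<tau> *\<^sub>R a \<in> P" "a \<notin> lineality P (p + \<tau> *\<^sub>R a)"
  let ?W = "lineality P (p + \<tau> *\<^sub>R a)"
  obtain i s where i: "i \<in> I" "s \<in> {1, -1}" "\<And>k. k \<in> I \<Longrightarrow> x k a = s * of_bool (k = i)"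
    using a(2) unfolding unit_form_def by blast
  have no: "\<not> attains ?W (\<lambda>k. of_bool (k = i))"
  proof
    assume "attains ?W (\<lambda>k. of_bool (k = i))"
    then obtain v where v: "v \<in> ?W" "\<forall>k\<in>I. x k v = of_bool (k = i)" by (auto simp: attains_def)
    then have "a = s *\<^sub>R v" by (intro coords_eqI) (auto simp: coords_simps i)
    then show False using q v subspace_scale[OF subspace_lineality[OF P_facts(3)]] by auto
  qed
  obtain \<epsilon> where \<epsilon>: "\<epsilon> i = (1::real)" "\<And>k. \<epsilon> k \<in> {-1, 0, 1}"
    "\<And>k. \<epsilon> k \<noteq> 0 \<Longrightarrow> attains ?W (\<lambda>l. of_bool (l = i) - \<epsilon> k * of_bool (l = k))"
    "\<And>w. w \<in> ?W \<Longrightarrow> (\<Sum>k\<in>I. \<epsilon> k * x k w) = 0"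
    using annihilator[OF Int_lower1 lineality_span[OF q(1)] i(1) no] by blast
  have "(\<Sum>k\<in>I. \<epsilon> k * x k a) = (\<Sum>k\<in>I. \<epsilon> k * (s * of_bool (k = i)))"
    by (intro sum.cong) (auto simp: i)
  also have "\<dots> = s" using sum_of_bool[OF i(1), of \<epsilon> s] \<epsilon>(1) by simp
  finally have "\<bar>\<Sum>k\<in>I. \<epsilon> k * x k a\<bar> = 1" using i(2) by auto
  moreover have "\<epsilon> k \<in> \<int>" for k using \<epsilon>(2)[of k] by auto
  ultimately show "\<exists>\<epsilon>. (\<forall>k\<in>I. \<epsilon> k \<in> \<int>) \<and> \<bar>\<Sum>k\<in>I. \<epsilon> k * x k a\<bar> = 1 \<and>
      (\<forall>w\<in>?W. (\<Sum>k\<in>I. \<epsilon> k * x k w) = 0)"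
    using \<epsilon>(4) by blast
qed

text \<open>
  Here \<open>W\<close> bounds the lineality space at the last point of \<open>P\<close> in direction \<open>a\<close>. As \<open>W\<close> contains neither
  \<open>e\<^sub>i\<close> nor \<open>e\<^sub>i - s t e\<^sub>j\<close>, and that lineality space does not contain \<open>a\<close>, the coefficient of the
  annihilator at \<open>j\<close> is 0.
\<close>
lemma pair_step:
  assumes p: "p \<in> P" "\<And>k. k \<in> I \<Longrightarrow> x k p \<in> \<int>" and a: "a \<in> tangent_cone p P"
    and i: "i \<in> I" "j \<in> I" "i \<noteq> j" and s: "s \<in> {1, -1}" "t \<in> {1, -1}"
    and coords: "\<And>k. k \<in> I \<Longrightarrow> x k a = s * of_bool (k = i) + t * of_bool (k = j)"
    and W: "\<And>\<tau>. 0 < \<tau> \<Longrightarrow> \<tau> < 1 \<Longrightarrow> p + \<tau> *\<^sub>R a \<in> P \<Longrightarrow>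
      (\<And>t. p + t *\<^sub>R a \<in> P \<Longrightarrow> t \<le> \<tau>) \<Longrightarrow> lineality P (p + \<tau> *\<^sub>R a) \<subseteq> W"
    and no: "\<not> attains W (\<lambda>k. of_bool (k = i))"
      "\<not> attains W (\<lambda>k. of_bool (k = i) - s * t * of_bool (k = j))"
  shows "p + a \<in> P"
proof (rule integral_step[OF p a(1)])
  fix \<tau> :: real
  assume \<tau>: "0 < \<tau>" "\<tau> < 1" and last: "\<And>t. p + t *\<^sub>R a \<in> P \<Longrightarrow> t \<le> \<tau>"
    and q: "p + \<tau> *\<^sub>R a \<in> P" "a \<notin> lineality P (p + \<tau> *\<^sub>R a)"
  let ?W = "lineality P (p + \<tau> *\<^sub>R a)"
  have sub: "?W \<subseteq> W" by (rule W[OF \<tau> q(1) last])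
  have no1: "\<not> attains ?W (\<lambda>k. of_bool (k = i))" using no(1) attains_mono[OF _ sub] by blast
  obtain \<epsilon> where \<epsilon>: "\<epsilon> i = (1::real)" "\<And>k. \<epsilon> k \<in> {-1, 0, 1}"
    "\<And>k. \<epsilon> k \<noteq> 0 \<Longrightarrow> attains ?W (\<lambda>l. of_bool (l = i) - \<epsilon> k * of_bool (l = k))"
    "\<And>w. w \<in> ?W \<Longrightarrow> (\<Sum>k\<in>I. \<epsilon> k * x k w) = 0"
    using annihilator[OF Int_lower1 lineality_span[OF q(1)] i(1) no1] by blast
  have "\<epsilon> j = 0"
  proof (rule ccontr)
    assume nz: "\<epsilon> j \<noteq> 0"
    have att: "attains ?W (\<lambda>l. of_bool (l = i) - \<epsilon> j * of_bool (l = j))" by (rule \<epsilon>(3)[OF nz])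
    then have "\<epsilon> j \<noteq> s * t" using no(2) attains_mono[OF _ sub] by auto
    then have e: "\<epsilon> j = - (s * t)" using \<epsilon>(2)[of j] nz s by auto
    obtain v where v: "v \<in> ?W" "\<forall>l\<in>I. x l v = of_bool (l = i) - \<epsilon> j * of_bool (l = j)"
      using att by (auto simp: attains_def)
    have "a = s *\<^sub>R v"
      by (intro coords_eqI) (use s in \<open>auto simp: coords_simps coords v e algebra_simps\<close>)
    then show False using q v subspace_scale[OF subspace_lineality[OF P_facts(3)]] by auto
  qed
  have "(\<Sum>k\<in>I. \<epsilon> k * x k a)
      = (\<Sum>k\<in>I. \<epsilon> k * (s * of_bool (k = i))) + (\<Sum>k\<in>I. \<epsilon> k * (t * of_bool (k = j)))"
    unfolding sum.distrib[symmetric] by (intro sum.cong) (auto simp: coords algebra_simps)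
  also have "\<dots> = s" using \<epsilon>(1) \<open>\<epsilon> j = 0\<close> by (simp only: sum_of_bool[OF i(1)] sum_of_bool[OF i(2)])
  finally have "\<bar>\<Sum>k\<in>I. \<epsilon> k * x k a\<bar> = 1" using s(1) by auto
  moreover have "\<epsilon> k \<in> \<int>" for k using \<epsilon>(2)[of k] by auto
  ultimately show "\<exists>\<epsilon>. (\<forall>k\<in>I. \<epsilon> k \<in> \<int>) \<and> \<bar>\<Sum>k\<in>I. \<epsilon> k * x k a\<bar> = 1 \<and>
      (\<forall>w\<in>?W. (\<Sum>k\<in>I. \<epsilon> k * x k w) = 0)"
    using \<epsilon>(4) by blast
qed

text \<open>
  The hypothesis \<open>minimal\<close> holds for extreme rays of the intersection of the tangent cone with a closed
  orthant. The point \<open>m\<close> lies strictly between \<open>p\<close> and a point of \<open>P\<close> on the ray.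
\<close>
lemma minimal_step:
  assumes p: "p \<in> P" "\<And>k. k \<in> I \<Longrightarrow> x k p \<in> \<int>" and v: "v \<in> tangent_cone p P" "v \<noteq> 0"
    and minimal: "\<And>u \<epsilon>. \<epsilon> > 0 \<Longrightarrow> v + \<epsilon> *\<^sub>R u \<in> tangent_cone p P \<Longrightarrow> v - \<epsilon> *\<^sub>R u \<in> tangent_cone p P \<Longrightarrow>
        (\<And>k. k \<in> I \<Longrightarrow> x k v = 0 \<Longrightarrow> x k u = 0) \<Longrightarrow> \<exists>c. u = c *\<^sub>R v"
  shows "v \<in> convex_cone hull {a. p + a \<in> P \<and> (unit_form a \<or> pair_form a)}"
proof -
  have T: "convex_cone (tangent_cone p P)" by (rule convex_cone_tangent_cone[OF P_facts(3)])
  obtain r where r: "r > 0" "p + r *\<^sub>R v \<in> P" using step_in_P[OF p(1) v(1)] by blast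
  define m where "m = p + (r/2) *\<^sub>R v"
  have m: "m \<in> P" unfolding m_def using r by (intro convex_step_le[OF P_facts(2) p(1) r(2)]) auto
  define W where "W = lineality P m"
  have vW: "v \<in> W" unfolding W_def using r p
    by (intro linealityI[of "r/2"]) (auto simp: m_def algebra_simps simp flip: scaleR_add_left)
  have minW: "\<exists>c. u = c *\<^sub>R v" if u: "u \<in> W" "\<And>k. k \<in> I \<Longrightarrow> x k v = 0 \<Longrightarrow> x k u = 0" for u
  proof -
    obtain e where e: "e > 0" "m + e *\<^sub>R u \<in> P" "m - e *\<^sub>R u \<in> P"
      using lineality_step_in_P[OF m] u(1) unfolding W_def by blast
    have "(2/r) *\<^sub>R (m + e *\<^sub>R u - p) \<in> tangent_cone p P" "(2/r) *\<^sub>R (m - e *\<^sub>R u - p) \<in> tangent_cone p P"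
      using r by (auto intro!: convex_cone_scaleR[OF T] diff_in_tangent_cone e)
    then show ?thesis
      using minimal[of "2/r * e" u] u(2) r(1) e(1) by (simp add: m_def algebra_simps)
  qed
  obtain c a where c: "c > 0" "v = c *\<^sub>R a" and form: "unit_form a \<or> pair_form a"
    using minimal_support_form[OF Int_lower1 lineality_span[OF m], folded W_def, OF vW v(2) minW]
    by blast
  have "a = (1/c) *\<^sub>R v" using c by simp
  then have aT: "a \<in> tangent_cone p P" using convex_cone_scaleR[OF T _ v(1), of "1/c"] c by simp
  have "p + a \<in> P"
  proof (cases "unit_form a")
    case True
    then show ?thesis by (intro unit_step[OF p aT]) auto
  next
    case False
    then obtain i j s t where i: "i \<in> I" "j \<in> I" "i \<noteq> j" and s: "s \<in> {1, -1}" "t \<in> {1, -1}"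
      and coords: "\<And>k. k \<in> I \<Longrightarrow> x k a = s * of_bool (k = i) + t * of_bool (k = j)"
      using form unfolding pair_form_def by blast
    have xv: "x k v = c * (s * of_bool (k = i) + t * of_bool (k = j))" if "k \<in> I" for k
      using that by (simp add: c coords_simps coords)
    have supp: "x k v = 0 \<Longrightarrow> k \<noteq> i \<and> k \<noteq> j" if "k \<in> I" for k
      using xv[OF that] i s c by auto
    show ?thesis
    proof (rule pair_step[OF p aT i s coords])
      fix \<tau> :: real
      assume \<tau>: "0 < \<tau>" "p + \<tau> *\<^sub>R a \<in> P" and last: "\<And>t. p + t *\<^sub>R a \<in> P \<Longrightarrow> t \<le> \<tau>"
      have "r * c \<le> \<tau>" using last[of "r * c"] r(2) c(2) by simp
      moreover have "0 < r * c" using r(1) c(1) by simp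
      ultimately have "lineality P (p + \<tau> *\<^sub>R a)
          \<subseteq> lineality P (p + (r * c / 2 / \<tau>) *\<^sub>R (p + \<tau> *\<^sub>R a - p))"
        using \<tau> by (intro lineality_segment[OF finite_roots polyhedron p(1)]) auto
      also have "p + (r * c / 2 / \<tau>) *\<^sub>R (p + \<tau> *\<^sub>R a - p) = m"
        using \<tau> c by (simp add: m_def)
      finally show "lineality P (p + \<tau> *\<^sub>R a) \<subseteq> W" by (simp add: W_def)
    next
      show "\<not> attains W (\<lambda>k. of_bool (k = i))"
      proof
        assume "attains W (\<lambda>k. of_bool (k = i))"
        then obtain u where u: "u \<in> W" "\<And>k. k \<in> I \<Longrightarrow> x k u = of_bool (k = i)"
          by (auto simp: attains_def)
        then obtain d where "u = d *\<^sub>R v" using minW[of u] supp by auto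
        then have "x i u = d * x i v" "x j u = d * x j v" using i by (auto simp: coords_simps)
        then show False using u(2) xv i s c by auto
      qed
      show "\<not> attains W (\<lambda>k. of_bool (k = i) - s * t * of_bool (k = j))"
      proof
        assume "attains W (\<lambda>k. of_bool (k = i) - s * t * of_bool (k = j))"
        then obtain u where u: "u \<in> W"
            "\<And>k. k \<in> I \<Longrightarrow> x k u = of_bool (k = i) - s * t * of_bool (k = j)"
          by (auto simp: attains_def)
        then obtain d where "u = d *\<^sub>R v" using minW[of u] supp by auto
        then have "x i u = d * x i v" "x j u = d * x j v" using i by (auto simp: coords_simps)
        then have "1 = d * c * s" "- (s * t) = d * c * t" using u(2) xv i s c by auto
        then show False using s by auto
      qed
    qed
  qed
  then have "a \<in> convex_cone hull {a. p + a \<in> P \<and> (unit_form a \<or> pair_form a)}"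
    using form by (simp add: hull_inc)
  then show ?thesis using c by (simp add: convex_cone_hull_mul)
qed

end

section \<open>Generation of tangent cones by unit and pair steps\<close>

context integral_polyhedron
begin
lemma linear_coords_bounded:
  obtains C where "\<And>u. (\<And>i. i \<in> I \<Longrightarrow> \<bar>x i u\<bar> \<le> 1) \<Longrightarrow> norm u \<le> C"
proof -
  define r where "r i = adjoint (x i) 1" for i
  have r: "r i \<bullet> u = x i u" if "i \<in> I" for i u
    using adjoint_works[OF linear_x[OF that], of u 1] by (simp add: r_def inner_commute)
  define g where "g u = (\<Sum>i\<in>I. x i u *\<^sub>R r i)" for u
  have lin: "linear g"
    by (rule linearI) (auto simp: g_def coords_simps algebra_simps sum.distrib scaleR_sum_right)
  have "inj g"
  proof (rule linear_injective_0[OF lin, THEN iffD2], intro allI impI)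
    fix u assume "g u = 0"
    then have "0 = g u \<bullet> u" by simp
    also have "\<dots> = (\<Sum>i\<in>I. x i u * x i u)" by (simp add: g_def inner_sum_left r)
    finally have "\<forall>i\<in>I. x i u * x i u = 0" using finite_I by (metis (no_types, lifting) sum_nonneg_eq_0_iff zero_le_square)
    then show "u = 0" using separating by auto
  qed
  then obtain B where B: "B > 0" "\<And>u. B * norm u \<le> norm (g u)"
    using linear_inj_bounded_below_pos[OF lin] by blast
  show thesis
  proof (rule that)
    fix u assume u: "\<And>i. i \<in> I \<Longrightarrow> \<bar>x i u\<bar> \<le> 1"
    have "norm (g u) \<le> (\<Sum>i\<in>I. norm (r i))"
      unfolding g_def using u by (intro sum_norm_le) (auto simp: mult_left_le_one_le)
    then show "norm u \<le> (\<Sum>i\<in>I. norm (r i)) / B"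
      using B(1) B(2)[of u] by (simp add: field_simps)
  qed
qed

text \<open>
  The slice \<open>K\<close> of the cone \<open>T\<close> consists of its vectors in the closed orthant with signs \<open>\<sigma>\<close> whose
  coordinates have absolute values summing to 1. At an extreme point \<open>v\<close> of \<open>K\<close>, a direction \<open>u\<close> in which
  \<open>T\<close> extends both ways and which keeps the zero coordinates of \<open>v\<close> is a multiple of \<open>v\<close>: after
  subtracting a multiple of \<open>v\<close> it would otherwise be a nonzero direction in which \<open>K\<close> extends both ways.
\<close>
lemma extreme_ray_minimal:
  fixes \<sigma> :: "'i \<Rightarrow> real" and T :: "'a set"
  assumes T: "convex_cone T" and \<sigma>: "\<And>i. i \<in> I \<Longrightarrow> \<bar>\<sigma> i\<bar> = 1"
    and K: "K = {u \<in> T. (\<forall>i\<in>I. 0 \<le> \<sigma> i * x i u) \<and> (\<Sum>i\<in>I. \<sigma> i * x i u) = 1}"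
    and v: "v extreme_point_of K"
    and u: "\<epsilon> > 0" "v + \<epsilon> *\<^sub>R u \<in> T" "v - \<epsilon> *\<^sub>R u \<in> T" "\<And>k. k \<in> I \<Longrightarrow> x k v = 0 \<Longrightarrow> x k u = 0"
  shows "\<exists>c. u = c *\<^sub>R v"
proof (rule ccontr)
  assume nex: "\<not> ?thesis"
  define h where "h w = (\<Sum>i\<in>I. \<sigma> i * x i w)" for w
  have h_simps: "h (a + b) = h a + h b" "h (a - b) = h a - h b" "h (c *\<^sub>R a) = c * h a" for a b c
    by (simp_all add: h_def coords_simps algebra_simps sum.distrib sum_subtractf sum_distrib_left)
  have vK: "v \<in> T" "\<And>i. i \<in> I \<Longrightarrow> 0 \<le> \<sigma> i * x i v" "h v = 1"
    using v by (auto simp: extreme_point_of_def K h_def)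
  define w where "w = u - h u *\<^sub>R v"
  have w0: "w \<noteq> 0" using nex by (auto simp: w_def)
  have hw: "h w = 0" by (simp add: w_def h_simps vK)
  have wsupp: "x k w = 0" if "k \<in> I" "x k v = 0" for k
    using that u(4) by (simp add: w_def coords_simps)
  have coord: "\<forall>\<^sub>F e in at_right 0. 0 \<le> \<sigma> i * x i (v + e *\<^sub>R w) \<and> 0 \<le> \<sigma> i * x i (v - e *\<^sub>R w)"
    if i: "i \<in> I" for i
  proof (cases "x i v = 0")
    case True
    then show ?thesis using i wsupp by (simp add: coords_simps)
  next
    case False
    then have "0 < \<sigma> i * x i v" using vK(2)[OF i] \<sigma>[OF i]
      by (metis abs_zero less_eq_real_def mult_eq_0_iff zero_neq_one)
    moreover have "((\<lambda>e. \<sigma> i * (x i v + e * x i w)) \<longlongrightarrow> \<sigma> i * (x i v + 0 * x i w)) (at_right 0)"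
      "((\<lambda>e. \<sigma> i * (x i v - e * x i w)) \<longlongrightarrow> \<sigma> i * (x i v - 0 * x i w)) (at_right 0)"
      by (intro tendsto_intros)+
    ultimately have "\<forall>\<^sub>F e in at_right 0. 0 < \<sigma> i * (x i v + e * x i w)"
      "\<forall>\<^sub>F e in at_right 0. 0 < \<sigma> i * (x i v - e * x i w)"
      by (auto dest!: order_tendstoD(1)[where a = 0])
    then show ?thesis by eventually_elim (use i in \<open>auto simp: coords_simps\<close>)
  qed
  \<comment> \<open>The size of the step is chosen so that the multiple of \<open>v\<close> used in \<open>inT\<close> below is nonnegative.\<close>
  have small: "\<forall>\<^sub>F e in at_right 0. e < 1 / (1 / \<epsilon> + \<bar>h u\<bar>)"
  proof -
    have "0 < 1 / (1 / \<epsilon> + \<bar>h u\<bar>)" using u(1) by (simp add: add_pos_nonneg)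
    from eventually_at_right_real[OF this] show ?thesis by eventually_elim simp
  qed
  have "\<forall>\<^sub>F e in at_right 0. \<forall>i\<in>I. 0 \<le> \<sigma> i * x i (v + e *\<^sub>R w) \<and> 0 \<le> \<sigma> i * x i (v - e *\<^sub>R w)"
    using coord by (intro eventually_ball_finite finite_I) auto
  then have "\<forall>\<^sub>F e in at_right 0. e > 0 \<and> e < 1 / (1 / \<epsilon> + \<bar>h u\<bar>) \<and>
      (\<forall>i\<in>I. 0 \<le> \<sigma> i * x i (v + e *\<^sub>R w) \<and> 0 \<le> \<sigma> i * x i (v - e *\<^sub>R w))"
    using small eventually_at_right_less[of 0] by eventually_elim auto
  from eventually_happens[OF this] obtain e :: real where e: "e > 0" "e < 1 / (1 / \<epsilon> + \<bar>h u\<bar>)"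
    "\<And>i. i \<in> I \<Longrightarrow> 0 \<le> \<sigma> i * x i (v + e *\<^sub>R w)" "\<And>i. i \<in> I \<Longrightarrow> 0 \<le> \<sigma> i * x i (v - e *\<^sub>R w)"
    by auto
  have bound: "e / \<epsilon> + e * \<bar>h u\<bar> < 1"
  proof -
    have "1 / \<epsilon> + \<bar>h u\<bar> > 0" using u(1) by (simp add: add_pos_nonneg)
    then have "e * (1 / \<epsilon> + \<bar>h u\<bar>) < 1" using e(2) by (simp add: field_simps)
    then show ?thesis by (simp add: algebra_simps)
  qed
  have inT: "v + (s * e) *\<^sub>R w \<in> T" if s: "s \<in> {1, -1}" and t: "v + (s * \<epsilon>) *\<^sub>R u \<in> T" for s
  proof -
    have "v + (s * e) *\<^sub>R w = (e / \<epsilon>) *\<^sub>R (v + (s * \<epsilon>) *\<^sub>R u) + (1 - e / \<epsilon> - s * e * h u) *\<^sub>R v"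
      using u(1) by (simp add: w_def algebra_simps)
    moreover have "s * e * h u \<le> e * \<bar>h u\<bar>" using s e(1) by (auto simp: abs_le_iff mult.assoc abs_if)
    then have "0 \<le> 1 - e / \<epsilon> - s * e * h u" using bound by linarith
    ultimately show ?thesis
      using u(1) e(1) t vK(1) by (auto intro!: convex_cone_add[OF T] convex_cone_scaleR[OF T])
  qed
  have "v + e *\<^sub>R w \<in> K" "v - e *\<^sub>R w \<in> K"
    using inT[of 1] inT[of "-1"] u e hw vK(3) h_simps unfolding K by (auto simp: h_def[symmetric])
  moreover have "v \<in> open_segment (v + e *\<^sub>R w) (v - e *\<^sub>R w)"
  proof -
    have "v = (1 - 1/2) *\<^sub>R (v + e *\<^sub>R w) + (1/2) *\<^sub>R (v - e *\<^sub>R w)"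
      by (simp add: algebra_simps flip: scaleR_add_left)
    moreover have "v + e *\<^sub>R w \<noteq> v - e *\<^sub>R w"
    proof
      assume "v + e *\<^sub>R w = v - e *\<^sub>R w"
      then have "(2 * e) *\<^sub>R w = 0" by (simp add: algebra_simps flip: scaleR_2)
      then show False using e w0 by simp
    qed
    ultimately show ?thesis unfolding in_segment by (intro conjI exI[of _ "1/2"]) auto
  qed
  ultimately show False using v unfolding extreme_point_of_def by blast
qed

text \<open>
  This much holds for all signed coordinate systems at once. The generating steps need not be roots;
  which of them are depends on the types of the components.
\<close>
theorem tangent_cone_short_steps:
  assumes p: "p \<in> P" "\<And>k. k \<in> I \<Longrightarrow> x k p \<in> \<int>" and v: "v \<in> tangent_cone p P"
  shows "v \<in> convex_cone hull {a. p + a \<in> P \<and> (unit_form a \<or> pair_form a)}"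
proof (cases "v = 0")
  case True
  then show ?thesis by (simp add: convex_cone_hull_contains_0)
next
  case False
  let ?C = "convex_cone hull {a. p + a \<in> P \<and> (unit_form a \<or> pair_form a)}"
  define T where "T = tangent_cone p P"
  have T: "convex_cone T" unfolding T_def by (rule convex_cone_tangent_cone[OF P_facts(3)])
  define \<sigma> :: "'i \<Rightarrow> real" where "\<sigma> i = (if x i v \<ge> 0 then 1 else -1)" for i
  define h where "h u = (\<Sum>i\<in>I. \<sigma> i * x i u)" for u
  define K where "K = {u \<in> T. (\<forall>i\<in>I. 0 \<le> \<sigma> i * x i u) \<and> (\<Sum>i\<in>I. \<sigma> i * x i u) = 1}"
  have \<sigma>: "\<bar>\<sigma> i\<bar> = 1" for i by (simp add: \<sigma>_def)
  have cont: "continuous_on UNIV (x i)" if "i \<in> I" for i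
    using linear_x[OF that] by (simp add: linear_continuous_on linear_linear)
  have lin_h: "linear h"
    by (rule linearI) (auto simp: h_def coords_simps algebra_simps sum.distrib sum_distrib_left)
  have cont_h: "continuous_on UNIV h"
    using lin_h by (simp add: linear_continuous_on linear_linear)
  have K_Int: "K = T \<inter> (\<Inter>i\<in>I. {u. 0 \<le> \<sigma> i * x i u}) \<inter> {u. h u = 1}" by (auto simp: K_def h_def)
  have "compact K"
  proof -
    have "closed K"
      unfolding K_Int T_def tangent_cone_def
      by (intro closed_Int closed_INT ballI closed_closure closed_Collect_le closed_Collect_eq
          continuous_on_mult continuous_on_const cont cont_h)
    moreover obtain C where C: "\<And>u. (\<And>i. i \<in> I \<Longrightarrow> \<bar>x i u\<bar> \<le> 1) \<Longrightarrow> norm u \<le> C"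
      using linear_coords_bounded by blast
    have "norm u \<le> C" if u: "u \<in> K" for u
    proof (rule C)
      fix i assume i: "i \<in> I"
      have "\<sigma> i * x i u \<le> (\<Sum>i\<in>I. \<sigma> i * x i u)"
        using u i finite_I by (intro member_le_sum) (auto simp: K_def)
      then have "\<bar>\<sigma> i * x i u\<bar> \<le> 1" using u i by (simp add: K_def)
      then show "\<bar>x i u\<bar> \<le> 1" by (simp add: abs_mult \<sigma>)
    qed
    then have "bounded K" by (auto simp: bounded_iff)
    ultimately show ?thesis by (simp add: compact_eq_bounded_closed)
  qed
  moreover have "convex K"
    unfolding K_Int
  proof (intro convex_Int convex_INT)
    show "convex T" using T by (simp add: convex_cone_def)
    show "convex {u. h u = 1}"
      using lin_h by (auto simp: convex_def linear_add linear_scale)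
    show "convex {u. 0 \<le> \<sigma> i * x i u}" if "i \<in> I" for i
      using that by (auto simp: convex_def coords_simps distrib_left mult.left_commute)
  qed
  ultimately have KM: "K = convex hull {u. u extreme_point_of K}" by (rule Krein_Milman_Minkowski)
  have "{u. u extreme_point_of K} \<subseteq> ?C"
  proof
    fix w assume "w \<in> {u. u extreme_point_of K}"
    then have ext: "w extreme_point_of K" by simp
    then have w: "w \<in> T" "h w = 1" by (auto simp: extreme_point_of_def K_def h_def)
    show "w \<in> ?C"
    proof (rule minimal_step[OF p])
      show "w \<in> tangent_cone p P" using w by (simp add: T_def)
      show "w \<noteq> 0" using w(2) linear_0[OF lin_h] by auto
      show "\<exists>c. u = c *\<^sub>R w"
        if "\<epsilon> > 0" "w + \<epsilon> *\<^sub>R u \<in> tangent_cone p P" "w - \<epsilon> *\<^sub>R u \<in> tangent_cone p P"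
          "\<And>k. k \<in> I \<Longrightarrow> x k w = 0 \<Longrightarrow> x k u = 0" for u \<epsilon>
        using that extreme_ray_minimal[OF T \<sigma> K_def ext, of \<epsilon> u] by (simp add: T_def)
    qed auto
  qed
  then have K_sub: "K \<subseteq> ?C" using KM convex_convex_cone_hull by (metis hull_minimal)
  have hv: "h v > 0"
  proof -
    obtain i where "i \<in> I" "x i v \<noteq> 0" using separating False by blast
    then show ?thesis unfolding h_def
      by (intro sum_pos2[OF finite_I, of i]) (auto simp: \<sigma>_def)
  qed
  have "(1 / h v) *\<^sub>R v \<in> K"
  proof -
    have "(1 / h v) *\<^sub>R v \<in> T" using hv v convex_cone_scaleR[OF T, of "1 / h v" v] by (simp add: T_def)
    moreover have "0 \<le> \<sigma> i * x i ((1 / h v) *\<^sub>R v)" if "i \<in> I" for i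
      using that hv by (simp add: coords_simps \<sigma>_def)
    moreover have "h ((1 / h v) *\<^sub>R v) = 1" using hv by (simp add: linear_scale[OF lin_h])
    ultimately show ?thesis by (simp add: K_def h_def)
  qed
  then have "h v *\<^sub>R ((1 / h v) *\<^sub>R v) \<in> ?C"
    by (rule convex_cone_hull_mul[OF subsetD[OF K_sub]]) (use hv in simp)
  then show ?thesis using hv by simp
qed
end

section \<open>Parity of coordinate sums\<close>

context signed_coordinates
begin

text \<open>
  In a root subspace without unit vectors, integral vectors have even coordinate sum: a nonzero
  coordinate \<open>i\<close> of \<open>w\<close> can be removed with a vector \<open>e\<^sub>i \<plusminus> e\<^sub>j\<close> of \<open>W\<close>, where \<open>j\<close> belongs to the support of \<open>w\<close>,
  and such a vector has even coordinate sum.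
\<close>
lemma even_coordinate_sum:
  assumes R: "R \<subseteq> \<Phi>" and W: "W = span R" and no: "\<And>i. i \<in> I \<Longrightarrow> \<not> attains W (\<lambda>k. of_bool (k = i))"
    and w: "w \<in> W" "\<And>k. k \<in> I \<Longrightarrow> x k w \<in> \<int>"
  shows "\<exists>n. (\<Sum>k\<in>I. x k w) = 2 * of_int n"
  using w
proof (induction "card {k \<in> I. x k w \<noteq> 0}" arbitrary: w rule: less_induct)
  case less
  show ?case
  proof (cases "\<forall>k\<in>I. x k w = 0")
    case True
    then show ?thesis by (intro exI[of _ 0]) simp
  next
    case False
    then obtain i where i: "i \<in> I" "x i w \<noteq> 0" by blast
    obtain \<epsilon> where \<epsilon>: "\<epsilon> i = (1::real)" "\<And>k. \<epsilon> k \<in> {-1, 0, 1}"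
      "\<And>k. \<epsilon> k \<noteq> 0 \<Longrightarrow> attains W (\<lambda>l. of_bool (l = i) - \<epsilon> k * of_bool (l = k))"
      "\<And>w. w \<in> W \<Longrightarrow> (\<Sum>k\<in>I. \<epsilon> k * x k w) = 0"
      using annihilator[OF R W i(1) no[OF i(1)]] by blast
    have "(\<Sum>k\<in>I - {i}. \<epsilon> k * x k w) \<noteq> 0"
      using \<epsilon>(4)[OF less(2)] i \<epsilon>(1) sum.remove[OF finite_I i(1), of "\<lambda>k. \<epsilon> k * x k w"] by simp
    then obtain j where j: "j \<in> I - {i}" "\<epsilon> j * x j w \<noteq> 0" by (meson sum.neutral)
    then have ej: "\<epsilon> j \<noteq> 0" by auto
    obtain u where u: "u \<in> W" "\<forall>k\<in>I. x k u = of_bool (k = i) - \<epsilon> j * of_bool (k = j)"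
      using \<epsilon>(3)[OF ej] by (auto simp: attains_def)
    define w' where "w' = w - x i w *\<^sub>R u"
    have xw': "x k w' = x k w - x i w * (of_bool (k = i) - \<epsilon> j * of_bool (k = j))" if "k \<in> I" for k
      using that u(2) by (simp add: w'_def coords_simps)
    have "{k \<in> I. x k w' \<noteq> 0} \<subset> {k \<in> I. x k w \<noteq> 0}"
    proof
      show "{k \<in> I. x k w' \<noteq> 0} \<subseteq> {k \<in> I. x k w \<noteq> 0}" using xw' i j by (auto simp: of_bool_def split: if_splits)
      have "x i w' = 0" using xw'[OF i(1)] j by auto
      then show "{k \<in> I. x k w' \<noteq> 0} \<noteq> {k \<in> I. x k w \<noteq> 0}" using i by blast
    qed
    then have "card {k \<in> I. x k w' \<noteq> 0} < card {k \<in> I. x k w \<noteq> 0}"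
      using finite_I by (intro psubset_card_mono) auto
    moreover have "w' \<in> W" unfolding w'_def W
      using u(1) less(2) W by (intro span_diff span_scale) auto
    moreover have "x k w' \<in> \<int>" if "k \<in> I" for k
    proof -
      have "\<epsilon> j \<in> \<int>" using \<epsilon>(2)[of j] by auto
      moreover have "(of_bool (k = i) :: real) \<in> \<int>" "(of_bool (k = j) :: real) \<in> \<int>" by auto
      ultimately show ?thesis unfolding xw'[OF that]
        by (intro Ints_diff Ints_mult less(3) that i(1))
    qed
    ultimately obtain n where n: "(\<Sum>k\<in>I. x k w') = 2 * of_int n" using less(1) by blast
    have "(\<Sum>k\<in>I. x k w') = (\<Sum>k\<in>I. x k w - 1 * (x i w * of_bool (k = i)) + 1 * (x i w * \<epsilon> j * of_bool (k = j)))"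
      by (intro sum.cong) (auto simp: xw' algebra_simps)
    also have "\<dots> = (\<Sum>k\<in>I. x k w) - (\<Sum>k\<in>I. 1 * (x i w * of_bool (k = i)))
        + (\<Sum>k\<in>I. 1 * (x i w * \<epsilon> j * of_bool (k = j)))"
      by (simp only: sum.distrib sum_subtractf)
    also have "\<dots> = (\<Sum>k\<in>I. x k w) - x i w + x i w * \<epsilon> j"
      using sum_of_bool[OF i(1), of "\<lambda>_. 1"] sum_of_bool[of j "\<lambda>_. 1"] j(1) by simp
    finally have eq: "(\<Sum>k\<in>I. x k w) = 2 * of_int n + x i w * (1 - \<epsilon> j)" using n by (simp add: algebra_simps)
    obtain m where m: "x i w = of_int m" using less(3)[OF i(1)] by (auto elim: Ints_cases)
    have "\<epsilon> j = 1 \<or> \<epsilon> j = -1" using \<epsilon>(2)[of j] ej by auto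
    then show ?thesis
    proof
      assume "\<epsilon> j = 1" then show ?thesis using eq by auto
    next
      assume "\<epsilon> j = -1"
      then have "(\<Sum>k\<in>I. x k w) = 2 * of_int (n + m)" using eq m by simp
      then show ?thesis by blast
    qed
  qed
qed

end

section \<open>Orthogonal projections\<close>

lemma orthogonal_projection_exists:
  fixes S :: "'a::euclidean_space set"
  obtains \<pi> where "linear \<pi>" "\<And>v. \<pi> v \<in> span S" "\<And>v. v \<in> span S \<Longrightarrow> \<pi> v = v"
    "\<And>u v. u \<in> S \<Longrightarrow> u \<bullet> (v - \<pi> v) = 0"
proof -
  obtain B where B: "B \<subseteq> span S" "pairwise orthogonal B" "\<And>b. b \<in> B \<Longrightarrow> norm b = 1"
    "independent B" "span B = span S"
    using orthonormal_basis_subspace[OF subspace_span[of S]] by metis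
  have fin: "finite B" using B(4) independent_imp_finite by blast
  define \<pi> where "\<pi> v = (\<Sum>b\<in>B. (v \<bullet> b) *\<^sub>R b)" for v
  have lin: "linear \<pi>"
    by (rule linearI) (auto simp: \<pi>_def inner_add_left algebra_simps sum.distrib scaleR_sum_right)
  have range: "\<pi> v \<in> span S" for v
    unfolding \<pi>_def using B(1) by (intro span_sum span_scale) auto
  have "b \<bullet> \<pi> v = b \<bullet> v" if b: "b \<in> B" for b v
  proof -
    have "b \<bullet> \<pi> v = (\<Sum>c\<in>B. (v \<bullet> c) * (b \<bullet> c))" by (simp add: \<pi>_def inner_sum_right)
    also have "\<dots> = (\<Sum>c\<in>B. if b = c then v \<bullet> b else 0)"
    proof (intro sum.cong refl)
      fix c assume c: "c \<in> B"
      show "(v \<bullet> c) * (b \<bullet> c) = (if b = c then v \<bullet> b else 0)"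
        using B(2,3) b c by (auto simp: pairwise_def orthogonal_def norm_eq_1)
    qed
    finally show ?thesis using fin b by (simp add: inner_commute)
  qed
  then have "\<And>b. b \<in> B \<Longrightarrow> (v - \<pi> v) \<bullet> b = 0" for v by (simp add: inner_diff_left inner_diff_right inner_commute)
  then have orth: "u \<bullet> (v - \<pi> v) = 0" if "u \<in> span S" for u v
    using that orthogonal_to_span[of u B "v - \<pi> v"] unfolding B(5) orthogonal_def
    by (simp add: inner_commute)
  show thesis
  proof (rule that[OF lin range])
    fix v assume "v \<in> span S"
    then have "v - \<pi> v \<in> span S" using range by (rule span_diff)
    then have "(v - \<pi> v) \<bullet> (v - \<pi> v) = 0" by (rule orth)
    then show "\<pi> v = v" by simp
  qed (use orth span_base in blast)
qed

text \<open>
  The orthogonal projection onto the span of \<open>S\<close>.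
\<close>
definition orth_proj :: "'a::euclidean_space set \<Rightarrow> 'a \<Rightarrow> 'a" where
  "orth_proj S = (SOME \<pi>. linear \<pi> \<and> (\<forall>v. \<pi> v \<in> span S) \<and> (\<forall>v\<in>span S. \<pi> v = v) \<and>
     (\<forall>u\<in>S. \<forall>v. u \<bullet> (v - \<pi> v) = 0))"

lemma
  shows proj_linear: "linear (orth_proj S)"
    and proj_in: "orth_proj S v \<in> span S"
    and proj_id: "v \<in> span S \<Longrightarrow> orth_proj S v = v"
    and proj_orth: "u \<in> S \<Longrightarrow> u \<bullet> (v - orth_proj S v) = 0"
proof -
  have "\<exists>\<pi>. linear \<pi> \<and> (\<forall>v. \<pi> v \<in> span S) \<and> (\<forall>v\<in>span S. \<pi> v = v) \<and>
     (\<forall>u\<in>S. \<forall>v. u \<bullet> (v - \<pi> v) = 0)"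
    by (rule orthogonal_projection_exists[of S]) blast
  from someI_ex[OF this, folded orth_proj_def]
  show "linear (orth_proj S)" "orth_proj S v \<in> span S" "v \<in> span S \<Longrightarrow> orth_proj S v = v"
    "u \<in> S \<Longrightarrow> u \<bullet> (v - orth_proj S v) = 0" by blast+
qed

section \<open>The root lattice and irreducible components\<close>

text \<open>
  Applied with \<open>c = 1\<close> for integrality and with \<open>c = 2\<close> for parity.
\<close>
lemma root_lattice_functional:
  fixes h :: "'a::euclidean_space \<Rightarrow> real"
  assumes h: "linear h" and roots: "\<And>\<alpha>. \<alpha> \<in> \<Phi> \<Longrightarrow> \<exists>n. h \<alpha> = c * of_int n" and z: "z \<in> root_lattice \<Phi>"
  shows "\<exists>n. h z = c * of_int n"
proof -
  obtain d where z: "z = (\<Sum>\<alpha>\<in>\<Phi>. of_int (d \<alpha>) *\<^sub>R \<alpha>)" using z by (auto simp: root_lattice_def)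
  obtain n where n: "\<And>\<alpha>. \<alpha> \<in> \<Phi> \<Longrightarrow> h \<alpha> = c * of_int (n \<alpha>)" using roots by metis
  have "h z = (\<Sum>\<alpha>\<in>\<Phi>. of_int (d \<alpha>) * (c * of_int (n \<alpha>)))"
    unfolding z using h n by (simp add: linear_sum linear_scale)
  also have "\<dots> = c * of_int (\<Sum>\<alpha>\<in>\<Phi>. d \<alpha> * n \<alpha>)" by (simp add: sum_distrib_left mult.left_commute)
  finally show ?thesis by blast
qed

lemma root_lattice_add_root:
  assumes "finite \<Phi>" "p \<in> root_lattice \<Phi>" "\<alpha> \<in> \<Phi>"
  shows "p + \<alpha> \<in> root_lattice \<Phi>"
proof -
  obtain d where d: "p = (\<Sum>\<beta>\<in>\<Phi>. of_int (d \<beta>) *\<^sub>R \<beta>)" using assms(2) by (auto simp: root_lattice_def)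
  have "(\<Sum>\<beta>\<in>\<Phi>. of_int ((d(\<alpha> := d \<alpha> + 1)) \<beta>) *\<^sub>R \<beta>) = p + \<alpha>"
    unfolding d sum.remove[OF assms(1,3)]
    by (simp add: algebra_simps cong: sum.cong_simp)
  then show ?thesis unfolding root_lattice_def
    by (intro CollectI exI[of _ "d(\<alpha> := d \<alpha> + 1)"] conjI TrueI) (rule sym)
qed

text \<open>
  The component of \<open>\<alpha>\<close> is a smallest set of roots that contains \<open>\<alpha>\<close> and is orthogonal to the remaining
  roots.
\<close>
lemma irreducible_component_exists:
  assumes \<Phi>: "root_system \<Phi>" and \<alpha>: "\<alpha> \<in> \<Phi>"
  obtains \<Psi> where "irreducible_component \<Phi> \<Psi>" "\<alpha> \<in> \<Psi>"
proof -
  define good where "good \<Psi> \<longleftrightarrow> \<Psi> \<subseteq> \<Phi> \<and> \<alpha> \<in> \<Psi> \<and> mutually_orthogonal \<Psi> (\<Phi> - \<Psi>)" for \<Psi>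
  have "good \<Phi>" using \<alpha> by (simp add: good_def mutually_orthogonal_def)
  then obtain \<Psi> where \<Psi>: "good \<Psi>" and least: "\<And>\<Psi>'. good \<Psi>' \<Longrightarrow> card \<Psi> \<le> card \<Psi>'"
    by (metis arg_min_nat_lemma)
  have sub: "\<Psi> \<subseteq> \<Phi>" and a: "\<alpha> \<in> \<Psi>" and orth: "mutually_orthogonal \<Psi> (\<Phi> - \<Psi>)"
    using \<Psi> by (auto simp: good_def)
  have fin: "finite \<Psi>" using sub \<Phi> finite_subset unfolding root_system_def by meson
  have nz: "0 \<notin> \<Phi>" and refl: "\<And>\<beta> \<gamma>. \<beta> \<in> \<Phi> \<Longrightarrow> \<gamma> \<in> \<Phi> \<Longrightarrow> reflection \<beta> \<gamma> \<in> \<Phi>"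
    and line: "\<And>\<beta>. \<beta> \<in> \<Phi> \<Longrightarrow> range (\<lambda>c. c *\<^sub>R \<beta>) \<inter> \<Phi> = {\<beta>, - \<beta>}"
    and int: "\<And>\<beta> \<gamma>. \<beta> \<in> \<Phi> \<Longrightarrow> \<gamma> \<in> \<Phi> \<Longrightarrow> \<beta> \<bullet> coroot \<gamma> \<in> \<int>"
    using \<Phi> unfolding root_system_def by meson+
  \<comment> \<open>A root that is a combination of elements of \<open>\<Psi>\<close> is not orthogonal to all of them.\<close>
  have closed: "\<gamma> \<in> \<Psi>" if \<gamma>: "\<gamma> \<in> \<Phi>" "\<gamma> \<in> span \<Psi>" for \<gamma>
  proof (rule ccontr)
    assume "\<gamma> \<notin> \<Psi>"
    then have "\<And>\<beta>. \<beta> \<in> \<Psi> \<Longrightarrow> orthogonal \<gamma> \<beta>"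
      using orth \<gamma> by (auto simp: mutually_orthogonal_def orthogonal_def inner_commute)
    then have "orthogonal \<gamma> \<gamma>" using \<gamma>(2) orthogonal_to_span by blast
    then show False using nz \<gamma>(1) by (simp add: orthogonal_self)
  qed
  have "root_system \<Psi>"
    unfolding root_system_def
  proof (intro conjI ballI)
    show "finite \<Psi>" by (rule fin)
    show "\<Psi> \<noteq> {}" using a by auto
    show "0 \<notin> \<Psi>" using nz sub by auto
    show "reflection \<beta> \<gamma> \<in> \<Psi>" if "\<beta> \<in> \<Psi>" "\<gamma> \<in> \<Psi>" for \<beta> \<gamma>
    proof (rule closed)
      show "reflection \<beta> \<gamma> \<in> \<Phi>" using that sub refl by blast
      show "reflection \<beta> \<gamma> \<in> span \<Psi>" unfolding reflection_def
        using that by (intro span_diff span_scale span_base)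
    qed
    show "range (\<lambda>c. c *\<^sub>R \<beta>) \<inter> \<Psi> = {\<beta>, - \<beta>}" if \<beta>: "\<beta> \<in> \<Psi>" for \<beta>
    proof -
      have on_line: "range (\<lambda>c. c *\<^sub>R \<beta>) \<inter> \<Phi> = {\<beta>, - \<beta>}"
        by (rule line) (use \<beta> sub in blast)
      then have "- \<beta> \<in> \<Phi>" by auto
      then have "- \<beta> \<in> \<Psi>" by (rule closed) (use \<beta> in \<open>simp add: span_neg span_base\<close>)
      have "range (\<lambda>c. c *\<^sub>R \<beta>) \<inter> \<Psi> = (range (\<lambda>c. c *\<^sub>R \<beta>) \<inter> \<Phi>) \<inter> \<Psi>"
        using sub by auto
      also have "\<dots> = {\<beta>, - \<beta>}" unfolding on_line using \<beta> \<open>- \<beta> \<in> \<Psi>\<close> by auto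
      finally show ?thesis .
    qed
    show "\<beta> \<bullet> coroot \<gamma> \<in> \<int>" if "\<beta> \<in> \<Psi>" "\<gamma> \<in> \<Psi>" for \<beta> \<gamma>
      using that sub int by blast
  qed
  moreover have split: False
    if A: "A \<noteq> {}" "B \<noteq> {}" "A \<union> B = \<Psi>" "A \<inter> B = {}" "mutually_orthogonal A B" "\<alpha> \<in> A" for A B
  proof -
    have "mutually_orthogonal A (\<Phi> - A)" using A orth unfolding mutually_orthogonal_def by blast
    then have "card \<Psi> \<le> card A" using A sub by (intro least) (auto simp: good_def)
    moreover have "card A < card \<Psi>" using A fin by (intro psubset_card_mono) auto
    ultimately show False by simp
  qed
  then have "\<not> (\<exists>A B. A \<noteq> {} \<and> B \<noteq> {} \<and> A \<union> B = \<Psi> \<and> A \<inter> B = {} \<and> mutually_orthogonal A B)"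
  proof (intro notI, elim exE conjE)
    fix A B
    assume AB: "A \<noteq> {}" "B \<noteq> {}" "A \<union> B = \<Psi>" "A \<inter> B = {}" "mutually_orthogonal A B"
    have BA: "B \<union> A = \<Psi>" "B \<inter> A = {}" using AB(3,4) by auto
    have orth_BA: "mutually_orthogonal B A"
      using AB(5) unfolding mutually_orthogonal_def by (metis inner_commute)
    from a AB(3) consider "\<alpha> \<in> A" | "\<alpha> \<in> B" by blast
    then show False
      by cases (use split[OF AB] split[OF AB(2,1) BA orth_BA] in blast)+
  qed
  ultimately have "irreducible_component \<Phi> \<Psi>"
    using sub orth unfolding irreducible_component_def irreducible_root_system_def by blast
  then show thesis using a by (rule that)
qed

lemma irreducible_component_subset:
  assumes "irreducible_component \<Phi> \<Psi>" "irreducible_component \<Phi> \<Psi>'" "\<Psi> \<inter> \<Psi>' \<noteq> {}"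
  shows "\<Psi> \<subseteq> \<Psi>'"
proof (rule ccontr)
  assume "\<not> \<Psi> \<subseteq> \<Psi>'"
  moreover have "mutually_orthogonal (\<Psi> \<inter> \<Psi>') (\<Psi> - \<Psi>')"
    using assms(1,2) unfolding irreducible_component_def mutually_orthogonal_def by blast
  ultimately have "\<exists>A B. A \<noteq> {} \<and> B \<noteq> {} \<and> A \<union> B = \<Psi> \<and> A \<inter> B = {} \<and> mutually_orthogonal A B"
    using assms(3) by (intro exI[of _ "\<Psi> \<inter> \<Psi>'"] exI[of _ "\<Psi> - \<Psi>'"]) auto
  moreover have "\<not> (\<exists>A B. A \<noteq> {} \<and> B \<noteq> {} \<and> A \<union> B = \<Psi> \<and> A \<inter> B = {} \<and> mutually_orthogonal A B)"
    using assms(1) unfolding irreducible_component_def irreducible_root_system_def by (elim conjE)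
  ultimately show False by (rule notE[rotated])
qed

lemma irreducible_components_disjoint:
  assumes "irreducible_component \<Phi> \<Psi>" "irreducible_component \<Phi> \<Psi>'" "\<Psi> \<inter> \<Psi>' \<noteq> {}"
  shows "\<Psi> = \<Psi>'"
  using irreducible_component_subset[OF assms] irreducible_component_subset[OF assms(2,1)] assms(3)
  by (simp add: Int_commute subset_antisym)

section \<open>The classical models\<close>

text \<open>
  The models by the number \<open>N\<close> of coordinates; type A of rank \<open>n\<close> has \<open>N = n + 1\<close>. No lower bounds on
  the rank are needed.
\<close>
definition classical_model :: "nat \<Rightarrow> (nat \<Rightarrow> real) set \<Rightarrow> bool" where
  "classical_model N M \<longleftrightarrow>
     (0 < N \<and> M = model_A (N - 1)) \<or> M = model_B N \<or> M = model_C N \<or> M = model_D N"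

lemma classical_type_model:
  assumes "classical_type \<Psi>"
  obtains N M f where "classical_model N M" "\<forall>k. linear (\<lambda>v. f v k)" "inj_on f (span \<Psi>)" "f ` \<Psi> = M"
proof -
  obtain N M where "classical_model N M" and iso: "isomorphic_to_model N \<Psi> M"
    using assms unfolding classical_type_def
  proof (elim disjE exE conjE)
    fix n assume "isomorphic_to_model (n + 1) \<Psi> (model_A n)"
    then show thesis using that[of "n + 1" "model_A n"] by (simp add: classical_model_def)
  qed (use that in \<open>auto simp: classical_model_def\<close>)
  then show thesis using that unfolding isomorphic_to_model_def by blast
qed

lemma model_D_iff:
  "m \<in> model_D N \<longleftrightarrow> (\<exists>i<N. \<exists>j<N. \<exists>s\<in>{1, -1}. \<exists>t\<in>{1, -1}. i \<noteq> j \<and>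
     m = (\<lambda>k. s * of_bool (k = i) + t * of_bool (k = j)))"
  unfolding model_D_def unit_coord_def of_bool_def by blast

lemma model_D_I:
  assumes "i < N" "j < N" "i \<noteq> j" "s \<in> {1, -1}" "t \<in> {1, -1}"
  shows "(\<lambda>k. s * of_bool (k = i) + t * of_bool (k = j)) \<in> model_D N"
  unfolding model_D_iff
  by (intro exI[of _ i] exI[of _ j] conjI bexI[of _ s] bexI[of _ t] assms refl)

lemma sum_of_bool_lessThan:
  fixes i N :: nat
  assumes "i < N" shows "(\<Sum>k<N. c * of_bool (k = i)) = (c::real)"
proof -
  have "(\<Sum>k<N. c * of_bool (k = i)) = (\<Sum>k<N. if i = k then c else 0)"
    by (intro sum.cong) auto
  then show ?thesis using assms by simp
qed

text \<open>
  What distinguishes the four types in the argument: which vectors are roots, and what is known about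
  coordinate sums.
\<close>
lemma classical_model_cases:
  assumes "classical_model N M"
  obtains
    (A) "\<And>m. m \<in> M \<Longrightarrow> (\<Sum>k<N. m k) = 0"
        "\<And>i j. i < N \<Longrightarrow> j < N \<Longrightarrow> i \<noteq> j \<Longrightarrow> (\<lambda>k. of_bool (k = i) - of_bool (k = j)) \<in> M"
  | (B) "\<And>i s. i < N \<Longrightarrow> s \<in> {1, -1} \<Longrightarrow> (\<lambda>k. s * of_bool (k = i)) \<in> M" "model_D N \<subseteq> M"
  | (C) "\<And>m. m \<in> M \<Longrightarrow> \<exists>n. (\<Sum>k<N. m k) = 2 * of_int n" "model_D N \<subseteq> M"
        "\<And>i s. i < N \<Longrightarrow> s \<in> {1, -1} \<Longrightarrow> (\<lambda>k. 2 * (s * of_bool (k = i))) \<in> M"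
  | (D) "\<And>m. m \<in> M \<Longrightarrow> \<exists>n. (\<Sum>k<N. m k) = 2 * of_int n" "M = model_D N"
proof -
  have even_D: "\<exists>n. (\<Sum>k<N. m k) = 2 * of_int n" if "m \<in> model_D N" for m
  proof -
    obtain i j s t where m: "i < N" "j < N" "s \<in> {1, -1}" "t \<in> {1, -1}"
      "m = (\<lambda>k. s * of_bool (k = i) + t * of_bool (k = j))"
      using \<open>m \<in> model_D N\<close> unfolding model_D_iff by blast
    have "(\<Sum>k<N. m k) = s + t"
      unfolding m(5) sum.distrib using m(1,2) by (simp only: sum_of_bool_lessThan)
    moreover have "s + t = 2 * of_int (if s = t then (if s = 1 then 1 else -1) else 0)" using m(3,4) by auto
    ultimately show ?thesis by metis
  qed
  consider "0 < N" "M = model_A (N - 1)" | "M = model_B N" | "M = model_C N" | "M = model_D N"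
    using assms unfolding classical_model_def by blast
  then show thesis
  proof cases
    case 1
    have "(\<Sum>k<N. m k) = 0" if m: "m \<in> M" for m
    proof -
      obtain i j where ij: "i \<le> N - 1" "j \<le> N - 1" "m = (\<lambda>k. unit_coord i k - unit_coord j k)"
        using m 1(2) unfolding model_A_def by blast
      then have "i < N" "j < N" using 1(1) by auto
      then show ?thesis
        using sum_of_bool_lessThan[of i N 1] sum_of_bool_lessThan[of j N 1]
        by (simp add: ij(3) unit_coord_def sum_subtractf of_bool_def)
    qed
    moreover have "(\<lambda>k. of_bool (k = i) - of_bool (k = j)) \<in> M" if "i < N" "j < N" "i \<noteq> j" for i j
    proof -
      have "i \<le> N - 1" "j \<le> N - 1" using that by auto
      then show ?thesis using that(3) 1(2) unfolding model_A_def unit_coord_def of_bool_def by blast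
    qed
    ultimately show thesis by (rule A)
  next
    case 2
    have "(\<lambda>k. s * of_bool (k = i)) \<in> M" if "i < N" "s \<in> {1, -1}" for i s
      using that 2 unfolding model_B_def unit_coord_def of_bool_def by blast
    moreover have "model_D N \<subseteq> M" using 2 by (simp add: model_B_def)
    ultimately show thesis by (rule B)
  next
    case 3
    have "\<exists>n. (\<Sum>k<N. m k) = 2 * of_int n" if mM: "m \<in> M" for m
    proof (cases "m \<in> model_D N")
      case False
      then have "m \<in> {(\<lambda>k. 2 * s * unit_coord i k) | s i. s \<in> {1, -1} \<and> i < N}"
        using mM 3 unfolding model_C_def by blast
      then obtain i s where m: "i < N" "s \<in> {1, -1}" "m = (\<lambda>k. 2 * s * of_bool (k = i))"
        unfolding unit_coord_def of_bool_def by blast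
      have "(\<Sum>k<N. m k) = 2 * s" unfolding m(3) using m(1) by (rule sum_of_bool_lessThan)
      moreover have "s = of_int (if s = 1 then 1 else -1)" using m(2) by auto
      ultimately show ?thesis by metis
    qed (rule even_D)
    moreover have "model_D N \<subseteq> M" using 3 by (simp add: model_C_def)
    moreover have "(\<lambda>k. 2 * (s * of_bool (k = i))) \<in> M" if "i < N" "s \<in> {1, -1}" for i s
    proof -
      have "(\<lambda>k. 2 * (s * of_bool (k = i))) = (\<lambda>k. 2 * s * unit_coord i k)"
        by (auto simp: unit_coord_def)
      then show ?thesis using that 3 unfolding model_C_def by blast
    qed
    ultimately show thesis by (rule C)
  next
    case 4
    then show thesis using even_D by (intro D) auto
  qed
qed

lemma classical_model_form:
  assumes "classical_model N M" "m \<in> M"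
  obtains (axis) i c where "i < N" "c \<noteq> 0" "c \<in> \<int>" "m = (\<lambda>k. c * of_bool (k = i))"
  | (pair) i j s t where "i < N" "j < N" "i \<noteq> j" "s \<in> {1, -1}" "t \<in> {1, -1}"
      "m = (\<lambda>k. s * of_bool (k = i) + t * of_bool (k = j))"
proof (cases "m \<in> model_D N")
  case True
  then show thesis using pair unfolding model_D_iff by blast
next
  case False
  note noD = this
  show thesis
  proof (cases "0 < N \<and> M = model_A (N - 1)")
    case True
    then obtain i j where "i \<le> N - 1" "j \<le> N - 1" "i \<noteq> j"
        "m = (\<lambda>k. unit_coord i k - unit_coord j k)"
      using assms(2) unfolding model_A_def by blast
    then show thesis using True by (intro pair[of i j 1 "-1"]) (auto simp: unit_coord_def)
  next
    case False
    then obtain i s where "i < N" "s \<in> {1, -1}"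
        "m = (\<lambda>k. s * unit_coord i k) \<or> m = (\<lambda>k. 2 * s * unit_coord i k)"
      using assms noD unfolding classical_model_def model_B_def model_C_def by blast
    then show thesis
    proof (elim disjE)
      assume "m = (\<lambda>k. s * unit_coord i k)"
      then show thesis using \<open>i < N\<close> \<open>s \<in> {1, -1}\<close> by (intro axis[of i s]) (auto simp: unit_coord_def)
    next
      assume "m = (\<lambda>k. 2 * s * unit_coord i k)"
      then show thesis using \<open>i < N\<close> \<open>s \<in> {1, -1}\<close> by (intro axis[of i "2 * s"]) (auto simp: unit_coord_def)
    qed
  qed
qed

section \<open>Block coordinates of a root system with classical components\<close>

text \<open>
  A root system together with a coordinate map \<open>f \<Psi>\<close> onto a classical model for each irreducible
  component \<open>\<Psi>\<close>.
\<close>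
locale classical_blocks =
  fixes \<Phi> :: "'a::euclidean_space set" and comps :: "'a set set" and N :: "'a set \<Rightarrow> nat"
    and M :: "'a set \<Rightarrow> (nat \<Rightarrow> real) set" and f :: "'a set \<Rightarrow> 'a \<Rightarrow> nat \<Rightarrow> real"
  assumes root_system: "root_system \<Phi>" and essential: "span \<Phi> = UNIV"
    and comps: "comps = {\<Psi>. irreducible_component \<Phi> \<Psi>}"
    and model: "\<Psi> \<in> comps \<Longrightarrow> classical_model (N \<Psi>) (M \<Psi>)"
    and f_linear: "\<Psi> \<in> comps \<Longrightarrow> linear (\<lambda>v. f \<Psi> v k)"
    and f_inj: "\<Psi> \<in> comps \<Longrightarrow> inj_on (f \<Psi>) (span \<Psi>)"
    and f_image: "\<Psi> \<in> comps \<Longrightarrow> f \<Psi> ` \<Psi> = M \<Psi>"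
begin

text \<open>
  A coordinate is indexed by a component and a number. As \<open>f \<Psi>\<close> is meaningful only on the span of \<open>\<Psi>\<close>, a
  vector is first projected to that span.
\<close>
definition I :: "('a set \<times> nat) set" where "I = Sigma comps (\<lambda>\<Psi>. {..<N \<Psi>})"

definition x :: "'a set \<times> nat \<Rightarrow> 'a \<Rightarrow> real" where "x i v = f (fst i) (orth_proj (fst i) v) (snd i)"

lemma I_iff [simp]: "(\<Psi>, k) \<in> I \<longleftrightarrow> \<Psi> \<in> comps \<and> k < N \<Psi>"
  by (simp add: I_def)

lemma finite_roots: "finite \<Phi>"
  using root_system by (simp add: root_system_def)

lemma comps_sub: "\<Psi> \<in> comps \<Longrightarrow> \<Psi> \<subseteq> \<Phi>"
  by (simp add: comps irreducible_component_def)

lemma comps_disjoint: "\<Psi> \<in> comps \<Longrightarrow> \<Psi>' \<in> comps \<Longrightarrow> \<Psi> \<noteq> \<Psi>' \<Longrightarrow> \<Psi> \<inter> \<Psi>' = {}"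
  using irreducible_components_disjoint[of \<Phi> \<Psi> \<Psi>'] by (auto simp: comps)

lemma in_comps: assumes "\<alpha> \<in> \<Phi>" obtains \<Psi> where "\<Psi> \<in> comps" "\<alpha> \<in> \<Psi>"
  using irreducible_component_exists[OF root_system assms] by (auto simp: comps)

lemma finite_comps: "finite comps"
  by (rule finite_subset[of _ "Pow \<Phi>"]) (use comps_sub finite_roots in auto)

lemma proj_eq_0:
  assumes "\<And>u. u \<in> \<Psi> \<Longrightarrow> u \<bullet> v = 0" shows "orth_proj \<Psi> v = 0"
proof -
  have "orthogonal (orth_proj \<Psi> v) u" if "u \<in> \<Psi>" for u
    using assms[OF that] proj_orth[OF that, of v] by (simp add: inner_diff_right orthogonal_def inner_commute)
  then have "orthogonal (orth_proj \<Psi> v) (orth_proj \<Psi> v)" using orthogonal_to_span proj_in by blast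
  then show ?thesis by (simp add: orthogonal_self)
qed

lemma proj_root:
  assumes "\<Psi> \<in> comps" "\<alpha> \<in> \<Phi>" shows "orth_proj \<Psi> \<alpha> = (if \<alpha> \<in> \<Psi> then \<alpha> else 0)"
proof (cases "\<alpha> \<in> \<Psi>")
  case True
  then show ?thesis by (simp add: proj_id span_base)
next
  case False
  then have "orth_proj \<Psi> \<alpha> = 0"
    using assms by (intro proj_eq_0) (auto simp: comps irreducible_component_def mutually_orthogonal_def)
  then show ?thesis using False by simp
qed

lemma proj_other:
  assumes "\<Psi> \<in> comps" "\<Psi>' \<in> comps" "\<Psi> \<noteq> \<Psi>'" "v \<in> span \<Psi>" shows "orth_proj \<Psi>' v = 0"
proof (rule linear_eq_0_on_span[OF proj_linear _ assms(4)])
  fix \<alpha> assume \<alpha>: "\<alpha> \<in> \<Psi>"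
  then have "\<alpha> \<in> \<Phi>" "\<alpha> \<notin> \<Psi>'" using comps_sub[OF assms(1)] comps_disjoint[OF assms(1-3)] by auto
  then show "orth_proj \<Psi>' \<alpha> = 0" using proj_root[OF assms(2)] by simp
qed

lemma f_zero: "\<Psi> \<in> comps \<Longrightarrow> f \<Psi> 0 k = 0"
  using linear_0[OF f_linear[of \<Psi> k]] by simp

lemma linear_x: "i \<in> I \<Longrightarrow> linear (x i)"
proof -
  assume i: "i \<in> I"
  have "linear ((\<lambda>v. f (fst i) v (snd i)) \<circ> orth_proj (fst i))"
    by (intro linear_compose proj_linear f_linear) (use i in \<open>auto simp: I_def\<close>)
  then show ?thesis by (simp add: x_def[abs_def] o_def)
qed

lemma x_root:
  assumes "\<Psi> \<in> comps" "\<alpha> \<in> \<Psi>" "\<Psi>' \<in> comps"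
  shows "x (\<Psi>', k) \<alpha> = (if \<Psi>' = \<Psi> then f \<Psi> \<alpha> k else 0)"
proof (cases "\<Psi>' = \<Psi>")
  case False
  have "orth_proj \<Psi>' \<alpha> = 0" using False by (intro proj_other[OF assms(1,3)] span_base assms(2)) auto
  then show ?thesis using False by (simp add: x_def f_zero[OF assms(3)])
qed (use assms in \<open>simp add: x_def proj_id span_base\<close>)

lemma f_beyond:
  assumes "\<Psi> \<in> comps" "v \<in> span \<Psi>" "N \<Psi> \<le> k" shows "f \<Psi> v k = 0"
proof (rule linear_eq_0_on_span[OF f_linear[OF assms(1)] _ assms(2)])
  fix \<alpha> assume "\<alpha> \<in> \<Psi>"
  then have m: "f \<Psi> \<alpha> \<in> M \<Psi>" using f_image[OF assms(1)] by blast
  show "f \<Psi> \<alpha> k = 0"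
    by (rule classical_model_form[OF model[OF assms(1)] m]) (use assms(3) in auto)
qed

lemma separating:
  assumes "\<And>i. i \<in> I \<Longrightarrow> x i v = 0" shows "v = 0"
proof -
  have "orth_proj \<Psi> v = 0" if \<Psi>: "\<Psi> \<in> comps" for \<Psi>
  proof (rule inj_onD[OF f_inj[OF \<Psi>]])
    have "f \<Psi> (orth_proj \<Psi> v) k = 0" for k
    proof (cases "k < N \<Psi>")
      case True
      then show ?thesis using assms[of "(\<Psi>, k)"] \<Psi> by (simp add: x_def)
    qed (use f_beyond[OF \<Psi> proj_in] in simp)
    then show "f \<Psi> (orth_proj \<Psi> v) = f \<Psi> 0" using f_zero[OF \<Psi>] by auto
  qed (auto simp: proj_in span_zero)
  then have "u \<bullet> v = 0" if "u \<in> \<Phi>" for u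
    using that in_comps[of u] proj_orth[of u _ v] by (metis diff_zero)
  then have "orthogonal v u" if "u \<in> \<Phi>" for u using that by (simp add: orthogonal_def inner_commute)
  then have "orthogonal v v" using orthogonal_to_span[of v \<Phi> v] essential by auto
  then show ?thesis by (simp add: orthogonal_self)
qed

lemma x_root_form:
  assumes \<alpha>: "\<alpha> \<in> \<Phi>"
  shows "(\<exists>i\<in>I. \<exists>m. \<forall>k\<in>I. m \<noteq> 0 \<and> x k \<alpha> = m * of_bool (k = i)) \<or>
      (\<exists>i\<in>I. \<exists>j\<in>I. \<exists>s\<in>{1, -1}. \<exists>t\<in>{1, -1}. i \<noteq> j \<and>
         (\<forall>k\<in>I. x k \<alpha> = s * of_bool (k = i) + t * of_bool (k = j)))"
proof -
  obtain \<Psi> where \<Psi>: "\<Psi> \<in> comps" "\<alpha> \<in> \<Psi>" using in_comps[OF \<alpha>] .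
  have m: "f \<Psi> \<alpha> \<in> M \<Psi>" using f_image[OF \<Psi>(1)] \<Psi>(2) by blast
  have xr: "x k \<alpha> = (if fst k = \<Psi> then f \<Psi> \<alpha> (snd k) else 0)" if "k \<in> I" for k
    using x_root[OF \<Psi>, of "fst k" "snd k"] that by (cases k) auto
  show ?thesis
  proof (rule classical_model_form[OF model[OF \<Psi>(1)] m])
    fix i c assume *: "i < N \<Psi>" "c \<noteq> 0" "f \<Psi> \<alpha> = (\<lambda>k. c * of_bool (k = i))"
    have "\<forall>k\<in>I. c \<noteq> 0 \<and> x k \<alpha> = c * of_bool (k = (\<Psi>, i))"
      using * by (auto simp: xr)
    then show ?thesis using * \<Psi>(1) I_iff by blast
  next
    fix i j s t
    assume *: "i < N \<Psi>" "j < N \<Psi>" "i \<noteq> j" "s \<in> {1, -1}" "t \<in> {1, -1}"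
      "f \<Psi> \<alpha> = (\<lambda>k. s * of_bool (k = i) + t * of_bool (k = j))"
    have "\<forall>k\<in>I. x k \<alpha> = s * of_bool (k = (\<Psi>, i)) + t * of_bool (k = (\<Psi>, j))"
      using * by (auto simp: xr)
    moreover have "(\<Psi>, i) \<noteq> (\<Psi>, j)" "(\<Psi>, i) \<in> I" "(\<Psi>, j) \<in> I" using * \<Psi>(1) by auto
    ultimately show ?thesis using *(4,5) by blast
  qed
qed

lemma x_root_Ints:
  assumes \<alpha>: "\<alpha> \<in> \<Phi>" and k: "k \<in> I" shows "x k \<alpha> \<in> \<int>"
proof -
  obtain \<Psi> where \<Psi>: "\<Psi> \<in> comps" "\<alpha> \<in> \<Psi>" using in_comps[OF \<alpha>] .
  have m: "f \<Psi> \<alpha> \<in> M \<Psi>" using f_image[OF \<Psi>(1)] \<Psi>(2) by blast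
  have "f \<Psi> \<alpha> l \<in> \<int>" for l
    by (rule classical_model_form[OF model[OF \<Psi>(1)] m]) auto
  then show ?thesis using x_root[OF \<Psi>, of "fst k" "snd k"] k by (cases k) auto
qed

sublocale signed_coordinates \<Phi> I x
proof (rule signed_coordinates.intro)
  show "finite I" unfolding I_def using finite_comps by auto
qed (fact linear_x separating x_root_form)+

lemma x_block:
  assumes "\<Psi> \<in> comps" "\<Psi>' \<in> comps"
  shows "x (\<Psi>', k) (orth_proj \<Psi> v) = (if \<Psi>' = \<Psi> then x (\<Psi>, k) v else 0)"
  using proj_other[OF assms _ proj_in] f_zero[OF assms(2)]
  by (auto simp: x_def proj_id[OF proj_in])

text \<open>
  A vector with the coordinates of a root is that root, by injectivity of the coordinates.
\<close>
lemma root_from_coords: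
  assumes \<Psi>: "\<Psi> \<in> comps" and m: "m \<in> M \<Psi>"
    and a: "\<And>\<Psi>' k. (\<Psi>', k) \<in> I \<Longrightarrow> x (\<Psi>', k) a = (if \<Psi>' = \<Psi> then m k else 0)"
  shows "a \<in> \<Psi>"
proof -
  have "m \<in> f \<Psi> ` \<Psi>" using m f_image[OF \<Psi>] by simp
  then obtain \<alpha> where \<alpha>: "\<alpha> \<in> \<Psi>" "f \<Psi> \<alpha> = m" by blast
  have "a = \<alpha>"
  proof (rule coords_eqI)
    fix i assume "i \<in> I"
    then show "x i a = x i \<alpha>" using a x_root[OF \<Psi> \<alpha>(1)] \<alpha>(2) by (cases i) auto
  qed
  then show ?thesis using \<alpha> by simp
qed

text \<open>
  The coordinate sum over one block.
\<close>
definition tot :: "'a set \<Rightarrow> 'a \<Rightarrow> real" where "tot \<Psi> v = (\<Sum>k<N \<Psi>. x (\<Psi>, k) v)"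

lemma linear_tot: assumes "\<Psi> \<in> comps" shows "linear (tot \<Psi>)"
  unfolding tot_def using assms by (intro linear_compose_sum ballI linear_x) auto

lemma tot_root:
  assumes "\<Psi> \<in> comps" "\<alpha> \<in> \<Phi>"
  shows "tot \<Psi> \<alpha> = (if \<alpha> \<in> \<Psi> then \<Sum>k<N \<Psi>. f \<Psi> \<alpha> k else 0)"
proof (cases "\<alpha> \<in> \<Psi>")
  case True
  then show ?thesis using x_root[OF assms(1) True assms(1)] by (simp add: tot_def)
next
  case False
  obtain \<Psi>' where \<Psi>': "\<Psi>' \<in> comps" "\<alpha> \<in> \<Psi>'" using in_comps[OF assms(2)] .
  then have "\<Psi> \<noteq> \<Psi>'" using False by auto
  then show ?thesis using x_root[OF \<Psi>' assms(1)] False by (simp add: tot_def)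
qed

lemma sum_block: assumes "\<Psi> \<in> comps" shows "(\<Sum>i\<in>I. x i (orth_proj \<Psi> v)) = tot \<Psi> v"
proof -
  have "(\<Sum>i\<in>I. x i (orth_proj \<Psi> v)) = (\<Sum>\<Psi>'\<in>comps. \<Sum>k<N \<Psi>'. x (\<Psi>', k) (orth_proj \<Psi> v))"
    unfolding I_def using finite_comps by (simp add: sum.Sigma)
  also have "\<dots> = (\<Sum>\<Psi>'\<in>comps. if \<Psi> = \<Psi>' then tot \<Psi> v else 0)"
    using x_block[OF assms] by (intro sum.cong) (auto simp: tot_def)
  finally show ?thesis using assms finite_comps by simp
qed

lemma lattice_coords_Ints:
  assumes "z \<in> root_lattice \<Phi>" "k \<in> I" shows "x k z \<in> \<int>"
proof -
  have "\<exists>n. x k \<alpha> = 1 * of_int n" if "\<alpha> \<in> \<Phi>" for \<alpha>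
    using x_root_Ints[OF that assms(2)] by (auto elim: Ints_cases)
  then obtain n where "x k z = 1 * of_int n"
    using root_lattice_functional[OF linear_x[OF assms(2)] _ assms(1)] by blast
  then show ?thesis by simp
qed

lemma proj_span:
  assumes "\<Psi> \<in> comps" "R \<subseteq> \<Phi>" "w \<in> span R" shows "orth_proj \<Psi> w \<in> span (R \<inter> \<Psi>)"
proof -
  have "orth_proj \<Psi> w \<in> span (orth_proj \<Psi> ` R)" using assms(3) linear_span_image[OF proj_linear] by blast
  moreover have "orth_proj \<Psi> ` R \<subseteq> span (R \<inter> \<Psi>)"
  proof (rule image_subsetI)
    fix \<alpha> assume \<alpha>: "\<alpha> \<in> R"
    then have "orth_proj \<Psi> \<alpha> = (if \<alpha> \<in> \<Psi> then \<alpha> else 0)" using proj_root[OF assms(1)] assms(2) by blast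
    then show "orth_proj \<Psi> \<alpha> \<in> span (R \<inter> \<Psi>)" using \<alpha> by (simp add: span_zero span_base)
  qed
  ultimately show ?thesis by (meson span_minimal subspace_span subsetD)
qed

end

section \<open>Tangent cones at lattice points\<close>

text \<open>
  The polyhedron spanned by an M-convex set, with a lattice point \<open>p\<close> of it.
\<close>
locale classical_polyhedron = classical_blocks +
  fixes P :: "'a set" and p :: 'a
  assumes poly: "M_convex_polyhedron \<Phi> P" and integral: "P = convex hull (P \<inter> root_lattice \<Phi>)"
    and p_in: "p \<in> P" "p \<in> root_lattice \<Phi>"
begin

sublocale integral_polyhedron \<Phi> I x P "root_lattice \<Phi>"
  by (intro integral_polyhedron.intro signed_coordinates_axioms integral_polyhedron_axioms.intro)
    (fact finite_roots poly integral lattice_coords_Ints)+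

text \<open>
  The cone generated by the root steps from \<open>p\<close> into \<open>P\<close>.
\<close>
definition neighbour_cone :: "'a set" where
  "neighbour_cone = convex_cone hull {\<alpha> \<in> \<Phi>. p + \<alpha> \<in> P}"

lemma p_Ints: "k \<in> I \<Longrightarrow> x k p \<in> \<int>" using lattice_coords_Ints p_in by blast

lemma root_step: "\<alpha> \<in> \<Psi> \<Longrightarrow> \<Psi> \<in> comps \<Longrightarrow> p + \<alpha> \<in> P \<Longrightarrow> \<alpha> \<in> neighbour_cone"
  unfolding neighbour_cone_def using comps_sub by (intro hull_inc) auto

lemma cone_add: "a \<in> neighbour_cone \<Longrightarrow> b \<in> neighbour_cone \<Longrightarrow> a + b \<in> neighbour_cone"
  unfolding neighbour_cone_def by (rule convex_cone_hull_add)

lemma cone_half: "2 *\<^sub>R a \<in> neighbour_cone \<Longrightarrow> a \<in> neighbour_cone"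
  unfolding neighbour_cone_def using convex_cone_hull_mul[of "2 *\<^sub>R a" _ "1/2"] by simp

text \<open>
  In a block with even coordinate sums, \<open>p + a\<close> with \<open>a = \<plusminus> e\<^sub>i\<close> has odd coordinate sum, whereas a lattice
  point \<open>z\<close> with \<open>z - (p + a)\<close> in the lineality space has even coordinate sum. So the
  projection of the lineality space to this block contains an integral vector with odd coordinate sum.
  The projection is again spanned by roots of the lineality space, so it contains some \<open>e\<^sub>j\<close>.
\<close>
lemma axis_in_lineality:
  assumes \<Psi>: "\<Psi> \<in> comps" and even: "\<And>m. m \<in> M \<Psi> \<Longrightarrow> \<exists>n. (\<Sum>k<N \<Psi>. m k) = 2 * of_int n"
    and i: "i < N \<Psi>" and s: "s \<in> {1, -1}"
    and a: "\<And>k. k \<in> I \<Longrightarrow> x k a = s * of_bool (k = (\<Psi>, i))" and pa: "p + a \<in> P"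
  obtains j b where "j < N \<Psi>" "b \<in> span (\<Phi> \<inter> lineality P (p + a) \<inter> \<Psi>)"
    "\<And>k. k \<in> I \<Longrightarrow> x k b = of_bool (k = (\<Psi>, j))"
proof -
  let ?R = "\<Phi> \<inter> lineality P (p + a)"
  have roots: "\<exists>n. tot \<Psi> \<alpha> = 2 * of_int n" if "\<alpha> \<in> \<Phi>" for \<alpha>
  proof (cases "\<alpha> \<in> \<Psi>")
    case True
    then have "f \<Psi> \<alpha> \<in> M \<Psi>" using f_image[OF \<Psi>] by blast
    then show ?thesis using even True tot_root[OF \<Psi> that] by simp
  next
    case False
    then show ?thesis using tot_root[OF \<Psi> that] by (intro exI[of _ 0]) simp
  qed
  obtain z where z: "z \<in> root_lattice \<Phi>" "z - (p + a) \<in> lineality P (p + a)"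
    using lattice_point_near[OF pa] by blast
  obtain m n where mn: "tot \<Psi> z = 2 * of_int m" "tot \<Psi> p = 2 * of_int n"
    using root_lattice_functional[OF linear_tot[OF \<Psi>] roots] z(1) p_in(2) by blast
  define w where "w = orth_proj \<Psi> (z - (p + a))"
  have "tot \<Psi> a = (\<Sum>k<N \<Psi>. s * of_bool (k = i))"
    unfolding tot_def using a \<Psi> by (intro sum.cong) auto
  then have tot_a: "tot \<Psi> a = s" using sum_of_bool_lessThan[OF i] by simp
  have sum_w: "(\<Sum>k\<in>I. x k w) = 2 * of_int (m - n) - s"
    unfolding w_def sum_block[OF \<Psi>] using linear_tot[OF \<Psi>] mn tot_a
    by (simp add: linear_diff linear_add)
  have ints: "x k w \<in> \<int>" if k: "k \<in> I" for k
  proof -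
    obtain \<Psi>' l where kl: "k = (\<Psi>', l)" by (cases k)
    have "x k (z - (p + a)) \<in> \<int>"
      unfolding coords_simps[OF k] a[OF k] using s
      by (intro Ints_diff Ints_add Ints_mult lattice_coords_Ints[OF _ k] z(1) p_in(2)) auto
    then show ?thesis using x_block[OF \<Psi>, of \<Psi>' l] k by (auto simp: w_def kl)
  qed
  have w_in: "w \<in> span (?R \<inter> \<Psi>)"
    unfolding w_def by (rule proj_span[OF \<Psi> Int_lower1, of "z - (p + a)"])
      (use z(2) lineality_span[OF pa] in blast)
  have "\<not> (\<exists>n. (\<Sum>k\<in>I. x k w) = 2 * of_int n)"
  proof
    assume "\<exists>n. (\<Sum>k\<in>I. x k w) = 2 * of_int n"
    then obtain l :: int where "2 * of_int (m - n) - s = 2 * of_int l" using sum_w by auto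
    then have "s = of_int (2 * (m - n - l))" by simp
    moreover have "\<bar>s\<bar> = 1" using s by auto
    ultimately have "real_of_int \<bar>2 * (m - n - l)\<bar> = 1" by (simp only: of_int_abs)
    then have "\<bar>2 * (m - n - l)\<bar> = 1" by (simp only: of_int_eq_1_iff)
    then show False by presburger
  qed
  then obtain k0 where k0: "k0 \<in> I" "attains (span (?R \<inter> \<Psi>)) (\<lambda>k. of_bool (k = k0))"
    using even_coordinate_sum[of "?R \<inter> \<Psi>" _ w] w_in ints by blast
  then obtain b where b: "b \<in> span (?R \<inter> \<Psi>)" "\<And>k. k \<in> I \<Longrightarrow> x k b = of_bool (k = k0)"
    by (auto simp: attains_def)
  obtain \<Psi>' j where k0_eq: "k0 = (\<Psi>', j)" by (cases k0)
  have "\<Psi>' = \<Psi>"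
  proof (rule ccontr)
    assume "\<Psi>' \<noteq> \<Psi>"
    moreover have "orth_proj \<Psi> b = b" using b(1) span_mono[of "?R \<inter> \<Psi>" \<Psi>] by (intro proj_id) auto
    ultimately have "x k0 b = 0" using x_block[OF \<Psi>, of \<Psi>' j b] k0(1) by (simp add: k0_eq)
    then show False using b(2)[OF k0(1)] by simp
  qed
  then show thesis using that[of j b] b k0(1) k0_eq by auto
qed

lemma unit_in_cone:
  assumes \<Psi>: "\<Psi> \<in> comps" and i: "i < N \<Psi>" and s: "s \<in> {1, -1}"
    and a: "\<And>k. k \<in> I \<Longrightarrow> x k a = s * of_bool (k = (\<Psi>, i))" and pa: "p + a \<in> P"
  shows "a \<in> neighbour_cone"
proof -
  let ?W = "lineality P (p + a)"
  have sub: "subspace ?W" by (rule subspace_lineality[OF P_facts(3)])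
  have pa_Ints: "x k (p + a) \<in> \<int>" if "k \<in> I" for k
    using p_Ints[OF that] s by (auto simp: coords_simps[OF that] a[OF that])
  have unit_steps: "p + a + b \<in> P" "p + a - b \<in> P"
    if b: "b \<in> ?W" "j < N \<Psi>" "\<And>k. k \<in> I \<Longrightarrow> x k b = of_bool (k = (\<Psi>, j))" for b j
  proof -
    have "unit_form b" unfolding unit_form_def
      using b \<Psi> by (intro bexI[of _ "(\<Psi>, j)"] bexI[of _ 1]) auto
    moreover have "unit_form (- b)" unfolding unit_form_def
      using b \<Psi> by (intro bexI[of _ "(\<Psi>, j)"] bexI[of _ "-1"]) (auto simp: coords_simps)
    moreover have "b \<in> tangent_cone (p + a) P" "- b \<in> tangent_cone (p + a) P"
      using b(1) by (auto simp: lineality_def)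
    ultimately show "p + a + b \<in> P" "p + a - b \<in> P"
      using unit_step[OF pa pa_Ints, of b] unit_step[OF pa pa_Ints, of "- b"] by auto
  qed
  \<comment> \<open>If \<open>e\<^sub>j\<close> with \<open>j \<noteq> i\<close> lies in the lineality space at \<open>p + a\<close>, then \<open>a\<close> is the mean of the roots \<open>a \<plusminus> e\<^sub>j\<close>.\<close>
  have via_other: "a \<in> neighbour_cone"
    if M: "model_D (N \<Psi>) \<subseteq> M \<Psi>" and b: "b \<in> ?W" "j < N \<Psi>" "j \<noteq> i"
      "\<And>k. k \<in> I \<Longrightarrow> x k b = of_bool (k = (\<Psi>, j))" for b j
  proof -
    have "a + t *\<^sub>R b \<in> \<Psi>" if t: "t \<in> {1, -1}" for t
    proof (rule root_from_coords[OF \<Psi>])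
      show "(\<lambda>k. s * of_bool (k = i) + t * of_bool (k = j)) \<in> M \<Psi>"
        by (rule subsetD[OF M model_D_I]) (use i b(2,3) s t in auto)
      show "x (\<Psi>', k) (a + t *\<^sub>R b) = (if \<Psi>' = \<Psi> then s * of_bool (k = i) + t * of_bool (k = j) else 0)"
        if "(\<Psi>', k) \<in> I" for \<Psi>' k
        using that by (simp add: coords_simps[OF that] a[OF that] b(4)[OF that])
    qed
    from this[of 1] this[of "-1"] have "a + b \<in> \<Psi>" "a - b \<in> \<Psi>" by auto
    moreover have "p + (a + b) \<in> P" "p + (a - b) \<in> P"
      using unit_steps[OF b(1,2,4)] by (simp_all add: algebra_simps)
    ultimately have "a + b \<in> neighbour_cone" "a - b \<in> neighbour_cone"
      using root_step[OF _ \<Psi>] by blast+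
    then have "2 *\<^sub>R a \<in> neighbour_cone" using cone_add[of "a + b" "a - b"] by (simp add: scaleR_2)
    then show ?thesis by (rule cone_half)
  qed
  have W: "span (\<Phi> \<inter> ?W \<inter> \<Psi>) \<subseteq> ?W" by (intro span_minimal sub) auto
  show ?thesis
  proof (rule classical_model_cases[OF model[OF \<Psi>]])
    assume zero: "\<And>m. m \<in> M \<Psi> \<Longrightarrow> (\<Sum>k<N \<Psi>. m k) = 0"
    have "tot \<Psi> \<alpha> = 0" if "\<alpha> \<in> \<Phi>" for \<alpha>
      using zero f_image[OF \<Psi>] tot_root[OF \<Psi> that] by auto
    then have "tot \<Psi> a = 0"
      using linear_eq_0_on_span[OF linear_tot[OF \<Psi>], of \<Phi> a] essential by auto
    moreover have "tot \<Psi> a = (\<Sum>k<N \<Psi>. s * of_bool (k = i))"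
      unfolding tot_def using a \<Psi> by (intro sum.cong) auto
    ultimately have "s = 0" using sum_of_bool_lessThan[OF i] by simp
    then show ?thesis using s by auto
  next
    assume M: "\<And>i s. i < N \<Psi> \<Longrightarrow> s \<in> {1, -1} \<Longrightarrow> (\<lambda>k. s * of_bool (k = i)) \<in> M \<Psi>"
    have "a \<in> \<Psi>" by (rule root_from_coords[OF \<Psi> M[OF i s]]) (auto simp: a)
    then show ?thesis using \<Psi> pa by (rule root_step)
  next
    assume even: "\<And>m. m \<in> M \<Psi> \<Longrightarrow> \<exists>n. (\<Sum>k<N \<Psi>. m k) = 2 * of_int n"
      and D: "model_D (N \<Psi>) \<subseteq> M \<Psi>"
      and M: "\<And>i s. i < N \<Psi> \<Longrightarrow> s \<in> {1, -1} \<Longrightarrow> (\<lambda>k. 2 * (s * of_bool (k = i))) \<in> M \<Psi>"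
    obtain j b where j: "j < N \<Psi>" and b: "b \<in> span (\<Phi> \<inter> ?W \<inter> \<Psi>)"
      and xb: "\<And>k. k \<in> I \<Longrightarrow> x k b = of_bool (k = (\<Psi>, j))"
      using axis_in_lineality[OF \<Psi> even i s a pa] by blast
    have bW: "b \<in> ?W" using b W by blast
    show ?thesis
    proof (cases "j = i")
      case False
      show ?thesis by (rule via_other[OF D bW j False xb])
    next
      case True
      have ab: "a = s *\<^sub>R b" by (intro coords_eqI) (simp add: a coords_simps xb True)
      have "p + a + a \<in> P" using unit_steps[OF bW j xb] s unfolding ab by auto
      moreover have "2 *\<^sub>R a \<in> \<Psi>"
        by (rule root_from_coords[OF \<Psi> M[OF i s]]) (auto simp: a coords_simps simp del: I_iff)
      ultimately have "2 *\<^sub>R a \<in> neighbour_cone"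
        by (intro root_step[OF _ \<Psi>]) (simp_all add: scaleR_2 add.assoc)
      then show ?thesis by (rule cone_half)
    qed
  next
    assume even: "\<And>m. m \<in> M \<Psi> \<Longrightarrow> \<exists>n. (\<Sum>k<N \<Psi>. m k) = 2 * of_int n"
      and D: "M \<Psi> = model_D (N \<Psi>)"
    obtain j b where j: "j < N \<Psi>" and b: "b \<in> span (\<Phi> \<inter> ?W \<inter> \<Psi>)"
      and xb: "\<And>k. k \<in> I \<Longrightarrow> x k b = of_bool (k = (\<Psi>, j))"
      using axis_in_lineality[OF \<Psi> even i s a pa] by blast
    have bW: "b \<in> ?W" using b W by blast
    have jI: "(\<Psi>, j) \<in> I" using \<Psi> j by simp
    show ?thesis
    proof (cases "j = i")
      case False
      show ?thesis by (rule via_other[OF _ bW j False xb]) (simp add: D)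
    next
      case True
      \<comment> \<open>Some root \<open>\<plusminus> e\<^sub>i \<plusminus> e\<^sub>l\<close> lies in the lineality space, and with \<open>e\<^sub>i\<close> also \<open>e\<^sub>l\<close>.\<close>
      have "\<exists>\<beta>\<in>\<Phi> \<inter> ?W \<inter> \<Psi>. x (\<Psi>, j) \<beta> \<noteq> 0"
      proof (rule ccontr)
        assume "\<not> ?thesis"
        then have "x (\<Psi>, j) b = 0"
          using linear_eq_0_on_span[OF linear_x[OF jI] _ b] by blast
        then show False using xb[OF jI] by simp
      qed
      then obtain \<beta> where \<beta>: "\<beta> \<in> ?W" "\<beta> \<in> \<Psi>" "x (\<Psi>, j) \<beta> \<noteq> 0" by blast
      have "f \<Psi> \<beta> \<in> model_D (N \<Psi>)" using f_image[OF \<Psi>] \<beta>(2) D by blast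
      then obtain k l t u where kl: "k < N \<Psi>" "l < N \<Psi>" "k \<noteq> l" "t \<in> {1, -1}" "u \<in> {1, -1}"
        "f \<Psi> \<beta> = (\<lambda>n. t * of_bool (n = k) + u * of_bool (n = l))"
        unfolding model_D_iff by blast
      then have "j = k \<or> j = l" using \<beta>(3) x_root[OF \<Psi> \<beta>(2) \<Psi>, of j] by auto
      then have "\<exists>l t u. l < N \<Psi> \<and> l \<noteq> j \<and> t \<in> {1, -1} \<and> u \<in> {1, -1} \<and>
          (\<forall>n. f \<Psi> \<beta> n = t * of_bool (n = j) + u * of_bool (n = l))"
      proof
        assume "j = k"
        then show ?thesis using kl by (intro exI[of _ l] exI[of _ t] exI[of _ u]) auto
      next
        assume "j = l"
        then show ?thesis using kl by (intro exI[of _ k] exI[of _ u] exI[of _ t]) auto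
      qed
      then obtain l t u where l: "l < N \<Psi>" "l \<noteq> j" "t \<in> {1, -1}" "u \<in> {1, -1}"
        and f\<beta>: "\<And>n. f \<Psi> \<beta> n = t * of_bool (n = j) + u * of_bool (n = l)"
        by blast
      have "u *\<^sub>R (\<beta> - t *\<^sub>R b) \<in> ?W"
        using \<beta>(1) bW sub by (intro subspace_scale subspace_diff)
      moreover have "x n (u *\<^sub>R (\<beta> - t *\<^sub>R b)) = of_bool (n = (\<Psi>, l))" if n: "n \<in> I" for n
        using x_root[OF \<Psi> \<beta>(2), of "fst n" "snd n"] n l
        by (cases n) (auto simp: coords_simps xb f\<beta>)
      ultimately show ?thesis
        by (rule via_other[of "u *\<^sub>R (\<beta> - t *\<^sub>R b)" l, rotated 1, OF _ l(1) l(2)[unfolded True]])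
          (simp_all add: D)
    qed
  qed
qed

text \<open>
  The tangent cone is generated by roots, each of which is fixed or killed by the projection.
\<close>
lemma proj_tangent_cone:
  assumes \<Psi>: "\<Psi> \<in> comps" and a: "a \<in> tangent_cone p P" shows "orth_proj \<Psi> a \<in> tangent_cone p P"
proof -
  obtain R where R: "R \<subseteq> \<Phi>" "tangent_cone p P = convex_cone hull R"
    using poly p_in(1) unfolding M_convex_polyhedron_def M_convex_cone_def by meson
  have "convex_cone hull R \<subseteq> {v. orth_proj \<Psi> v \<in> convex_cone hull R}"
  proof (rule hull_minimal)
    show "R \<subseteq> {v. orth_proj \<Psi> v \<in> convex_cone hull R}"
      using R(1) proj_root[OF \<Psi>] by (auto simp: hull_inc convex_cone_hull_contains_0)
    show "convex_cone {v. orth_proj \<Psi> v \<in> convex_cone hull R}"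
      using proj_linear[of \<Psi>] by (subst convex_cone_iff)
        (auto simp: linear_0 linear_add linear_scale convex_cone_hull_contains_0
          intro: convex_cone_hull_add convex_cone_hull_mul)
  qed
  then show ?thesis using a R(2) by auto
qed

lemma pair_in_cone:
  assumes "pair_form a" and pa: "p + a \<in> P" shows "a \<in> neighbour_cone"
proof -
  obtain \<Psi> i \<Psi>' j s t where \<Psi>: "\<Psi> \<in> comps" "i < N \<Psi>" "\<Psi>' \<in> comps" "j < N \<Psi>'"
    and ne: "(\<Psi>, i) \<noteq> (\<Psi>', j)" and st: "s \<in> {1, -1}" "t \<in> {1, -1}"
    and a: "\<And>k. k \<in> I \<Longrightarrow> x k a = s * of_bool (k = (\<Psi>, i)) + t * of_bool (k = (\<Psi>', j))"
    using assms(1) unfolding pair_form_def by (metis I_iff surj_pair)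
  show ?thesis
  proof (cases "\<Psi>' = \<Psi>")
    case True
    have "(\<lambda>k. s * of_bool (k = i) + t * of_bool (k = j)) \<in> M \<Psi>"
    proof (rule classical_model_cases[OF model[OF \<Psi>(1)]])
      assume zero: "\<And>m. m \<in> M \<Psi> \<Longrightarrow> (\<Sum>k<N \<Psi>. m k) = 0"
        and M: "\<And>i j. i < N \<Psi> \<Longrightarrow> j < N \<Psi> \<Longrightarrow> i \<noteq> j \<Longrightarrow> (\<lambda>k. of_bool (k = i) - of_bool (k = j)) \<in> M \<Psi>"
      have "tot \<Psi> \<alpha> = 0" if "\<alpha> \<in> \<Phi>" for \<alpha>
        using zero f_image[OF \<Psi>(1)] tot_root[OF \<Psi>(1) that] by auto
      then have "tot \<Psi> a = 0"
        using linear_eq_0_on_span[OF linear_tot[OF \<Psi>(1)], of \<Phi> a] essential by auto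
      moreover have "tot \<Psi> a = (\<Sum>k<N \<Psi>. s * of_bool (k = i) + t * of_bool (k = j))"
        unfolding tot_def using a \<Psi> True by (intro sum.cong) auto
      ultimately have "s + t = 0"
        using sum_of_bool_lessThan[OF \<Psi>(2), of s] sum_of_bool_lessThan[of j "N \<Psi>" t] \<Psi>(4) True
        by (simp add: sum.distrib)
      then have "s = 1 \<and> t = -1 \<or> s = -1 \<and> t = 1" using st by auto
      then show ?thesis
      proof
        assume "s = 1 \<and> t = -1"
        then show ?thesis using M[of i j] \<Psi> True ne by simp
      next
        assume "s = -1 \<and> t = 1"
        then show ?thesis using M[of j i] \<Psi> True ne by simp
      qed
    next
      assume D: "model_D (N \<Psi>) \<subseteq> M \<Psi>"
      show ?thesis by (rule subsetD[OF D model_D_I]) (use \<Psi> ne st True in auto)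
    next
      assume D: "model_D (N \<Psi>) \<subseteq> M \<Psi>"
      show ?thesis by (rule subsetD[OF D model_D_I]) (use \<Psi> ne st True in auto)
    next
      assume D: "M \<Psi> = model_D (N \<Psi>)"
      show ?thesis unfolding D by (rule model_D_I) (use \<Psi> ne st True in auto)
    qed
    then have "a \<in> \<Psi>"
      by (rule root_from_coords[OF \<Psi>(1)]) (auto simp: a True)
    then show ?thesis using \<Psi>(1) pa by (rule root_step)
  next
    case False
    \<comment> \<open>Across two blocks, both projections of \<open>a\<close> are tangent directions of unit form.\<close>
    have aT: "a \<in> tangent_cone p P" using diff_in_tangent_cone[OF pa, of p] by simp
    have coords1: "x k (orth_proj \<Psi> a) = s * of_bool (k = (\<Psi>, i))" if "k \<in> I" for k
      using that x_block[OF \<Psi>(1)] a False by (cases k) auto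
    have coords2: "x k (orth_proj \<Psi>' a) = t * of_bool (k = (\<Psi>', j))" if "k \<in> I" for k
      using that x_block[OF \<Psi>(3)] a False by (cases k) auto
    have "unit_form (orth_proj \<Psi> a)" "unit_form (orth_proj \<Psi>' a)"
      unfolding unit_form_def using coords1 coords2 st \<Psi> by (metis I_iff)+
    then have "p + orth_proj \<Psi> a \<in> P" "p + orth_proj \<Psi>' a \<in> P"
      using unit_step[OF p_in(1) p_Ints] proj_tangent_cone[OF _ aT] \<Psi> by auto
    then have "orth_proj \<Psi> a + orth_proj \<Psi>' a \<in> neighbour_cone"
      using unit_in_cone[OF \<Psi>(1,2) st(1) coords1] unit_in_cone[OF \<Psi>(3,4) st(2) coords2]
      by (intro cone_add) auto
    moreover have "a = orth_proj \<Psi> a + orth_proj \<Psi>' a"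
      by (rule coords_eqI) (simp add: coords_simps coords1 coords2 a)
    ultimately show ?thesis by simp
  qed
qed

lemma tangent_cone_subset: "tangent_cone p P \<subseteq> neighbour_cone"
proof
  fix v assume "v \<in> tangent_cone p P"
  then have "v \<in> convex_cone hull {a. p + a \<in> P \<and> (unit_form a \<or> pair_form a)}"
    using p_in(1) p_Ints by (intro tangent_cone_short_steps)
  moreover have "{a. p + a \<in> P \<and> (unit_form a \<or> pair_form a)} \<subseteq> neighbour_cone"
  proof (rule subsetI, elim CollectE conjE disjE)
    fix a assume pa: "p + a \<in> P" and "unit_form a"
    then obtain i s where i: "i \<in> I" "s \<in> {1, -1}" "\<And>k. k \<in> I \<Longrightarrow> x k a = s * of_bool (k = i)"
      unfolding unit_form_def by blast
    obtain \<Psi> k where ik: "i = (\<Psi>, k)" by (cases i)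
    show "a \<in> neighbour_cone"
      by (rule unit_in_cone[of \<Psi> k s]) (use i pa in \<open>auto simp: ik\<close>)
  next
    fix a assume "p + a \<in> P" "pair_form a"
    then show "a \<in> neighbour_cone" by (intro pair_in_cone)
  qed
  then have "convex_cone hull {a. p + a \<in> P \<and> (unit_form a \<or> pair_form a)} \<subseteq> neighbour_cone"
    unfolding neighbour_cone_def by (rule hull_minimal) (rule convex_cone_convex_cone_hull)
  ultimately show "v \<in> neighbour_cone" by blast
qed

end

theorem proposition6p8:
  fixes \<Phi> B :: "'a::euclidean_space set" and p :: 'a
  assumes "root_system \<Phi>"
    and "essential \<Phi>"
    and "\<forall>\<Psi>. irreducible_component \<Phi> \<Psi> \<longrightarrow> classical_type \<Psi>"
    and "M_convex_set \<Phi> B"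
    and "p \<in> B"
  shows "tangent_cone p (convex hull B) = convex_cone hull {\<alpha> \<in> \<Phi>. p + \<alpha> \<in> B}"
proof -
  obtain P where P: "integral_M_convex_polyhedron \<Phi> P" "B = P \<inter> root_lattice \<Phi>"
    using assms(4) by (auto simp: M_convex_set_def)
  have hull_B: "convex hull B = P" and poly: "M_convex_polyhedron \<Phi> P"
    using P by (auto simp: integral_M_convex_polyhedron_def)
  have fin: "finite \<Phi>" using assms(1) by (simp add: root_system_def)
  have p: "p \<in> P" "p \<in> root_lattice \<Phi>" using assms(5) P(2) by auto
  have neighbours: "{\<alpha> \<in> \<Phi>. p + \<alpha> \<in> B} = {\<alpha> \<in> \<Phi>. p + \<alpha> \<in> P}"
    using root_lattice_add_root[OF fin p(2)] by (auto simp: P(2))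
  define comps where "comps = {\<Psi>. irreducible_component \<Phi> \<Psi>}"
  define good :: "'a set \<Rightarrow> nat \<times> (nat \<Rightarrow> real) set \<times> ('a \<Rightarrow> nat \<Rightarrow> real) \<Rightarrow> bool" where
    "good \<Psi> = (\<lambda>(N, M, f). classical_model N M \<and> (\<forall>k. linear (\<lambda>v. f v k)) \<and>
       inj_on f (span \<Psi>) \<and> f ` \<Psi> = M)" for \<Psi>
  have "\<forall>\<Psi>\<in>comps. \<exists>d. good \<Psi> d"
  proof
    fix \<Psi> assume "\<Psi> \<in> comps"
    then have "classical_type \<Psi>" using assms(3) by (simp add: comps_def)
    then obtain N M f where "classical_model N M" "\<forall>k. linear (\<lambda>v. f v k)" "inj_on f (span \<Psi>)" "f ` \<Psi> = M"
      by (rule classical_type_model)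
    then have "good \<Psi> (N, M, f)" by (simp add: good_def)
    then show "\<exists>d. good \<Psi> d" by blast
  qed
  from bchoice[OF this] obtain d where d: "\<forall>\<Psi>\<in>comps. good \<Psi> (d \<Psi>)" by blast
  interpret classical_polyhedron \<Phi> comps "\<lambda>\<Psi>. fst (d \<Psi>)" "\<lambda>\<Psi>. fst (snd (d \<Psi>))"
    "\<lambda>\<Psi>. snd (snd (d \<Psi>))" P p
  proof (intro classical_polyhedron.intro classical_blocks.intro classical_polyhedron_axioms.intro)
    show "classical_model (fst (d \<Psi>)) (fst (snd (d \<Psi>)))" if "\<Psi> \<in> comps" for \<Psi>
      using d that by (auto simp: good_def case_prod_beta)
    show "linear (\<lambda>v. snd (snd (d \<Psi>)) v k)" if "\<Psi> \<in> comps" for \<Psi> k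
      using d that by (auto simp: good_def case_prod_beta)
    show "inj_on (snd (snd (d \<Psi>))) (span \<Psi>)" if "\<Psi> \<in> comps" for \<Psi>
      using d that by (auto simp: good_def case_prod_beta)
    show "snd (snd (d \<Psi>)) ` \<Psi> = fst (snd (d \<Psi>))" if "\<Psi> \<in> comps" for \<Psi>
      using d that by (auto simp: good_def case_prod_beta)
  qed (use assms(1,2) poly hull_B P(2) p in \<open>simp_all add: essential_def comps_def\<close>)
  have "convex_cone hull {\<alpha> \<in> \<Phi>. p + \<alpha> \<in> P} \<subseteq> tangent_cone p P"
  proof (rule hull_minimal)
    show "{\<alpha> \<in> \<Phi>. p + \<alpha> \<in> P} \<subseteq> tangent_cone p P"
      using diff_in_tangent_cone[of _ P p] by force
    show "convex_cone (tangent_cone p P)" using p by (intro convex_cone_tangent_cone) auto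
  qed
  moreover have "tangent_cone p P \<subseteq> convex_cone hull {\<alpha> \<in> \<Phi>. p + \<alpha> \<in> P}"
    using tangent_cone_subset by (simp only: neighbour_cone_def)
  ultimately show ?thesis unfolding hull_B neighbours by (rule subset_antisym[rotated])
qed

end
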